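(* Let $(\mathcal{U},\mathcal{U}^\diamond)$ be a dual pair of Banach spaces. If $(\mathcal{B},\mathcal{B}^\diamond)$ is an adjoint vv-RKBS pair with reproducing kernel $K\colon X\times\Omega\to\mathrm{Twin}(\mathcal{U},\mathcal{U}^\diamond)$, then the kernel $K$ is unique, satisfies, for all $x\in X$, $w\in\Omega$, $u\in\mathcal{U}$, $u^\diamond\in\mathcal{U}^\diamond$, the equalities $$K(x,w)(u^\diamond,u)=\langle K_{\mathcal{U}^\diamond}(x,\cdot)u^\diamond,K_{\mathcal{U}}(\cdot,w)u\rangle_{\mathcal{B}}=\langle K_{\mathcal{U}^\diamond}(x,w)u^\diamond,u\rangle_{\mathcal{U}}=\langle u^\diamond,K_{\mathcal{U}}(x,w)u\rangle_{\mathcal{U}},$$ and the bounds $$\|K_{\mathcal{U}}(x,w)u\|_{\mathcal{U}}\le C_X(x)\,\|K_{\mathcal{U}}(\cdot,w)u\|_{\mathcal{B}}=:C_X(x)\,C_{\Omega\times\mathcal{U}}(w,u),$$ $$\|K_{\mathcal{U}^\diamond}(x,w)u^\diamond\|_{\mathcal{U}^\diamond}\le C_\Omega(w)\,\|K_{\mathcal{U}^\diamond}(x,\cdot)u^\diamond\|_{\mathcal{B}^\diamond}=:C_\Omega(w)\,C_{X\times\mathcal{U}^\diamond}(x,u^\diamond)$$ for some functions $C_X\colon X\to\mathbb{R}^+$ and $C_\Omega\colon\Omega\to\mathbb{R}^+$. Conversely, if we are given a continuous dual pair $(\mathcal{U},\mathcal{U}^\diamond)$, sets $X,\Omega$, and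 a map $K\colon X\times\Omega\to\mathrm{Twin}(\mathcal{U},\mathcal{U}^\diamond)$ that satisfies, for all $x,w,u,u^\diamond$, $$\|K_{\mathcal{U}}(x,w)u\|_{\mathcal{U}}\le C_X(x)\,C_{\Omega\times\mathcal{U}}(w,u)\quad\text{and}\quad\|K_{\mathcal{U}^\diamond}(x,w)u^\diamond\|_{\mathcal{U}^\diamond}\le C_\Omega(w)\,C_{X\times\mathcal{U}^\diamond}(x,u^\diamond)$$ for some functions $C_X\colon X\to\mathbb{R}^+$, $C_\Omega\colon\Omega\to\mathbb{R}^+$, $C_{\Omega\times\mathcal{U}}\colon\Omega\times\mathcal{U}\to\mathbb{R}^+$ and $C_{X\times\mathcal{U}^\diamond}\colon X\times\mathcal{U}^\diamond\to\mathbb{R}^+$, then there exists an adjoint vv-RKBS pair $(\mathcal{B},\mathcal{B}^\diamond)$ with domains $X$ and $\Omega$, respectively, and $K$ as reproducing kernel. Moreover, when additionally assuming $$\|u^\diamond\|_{\mathcal{U}^\diamond}=\sup_{\|u\|_{\mathcal{U}}\le1}|\langle u^\diamond,u\rangle_{\mathcal{U}}|\ \text{ for all }u^\diamond\in\mathcal{U}^\diamond\quad\text{and}\quad\|K_{\mathcal{U}}(x,w)u\|_{\mathcal{U}}\le C_X(x)\,C_\Omega(w)\,\|u\|_{\mathcal{U}}\ \text{ for all }x,w,u,$$ one can define such an adjoint vv-RKBS pair $(\mathcal{B},\mathcal{B}^\diamond)$ satisfying $\|g\|_{\mathcal{B}^\diamond}=\sup_{\|f\|_{\mathcal{B}}\le1}|\langle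 g,f\rangle_{\mathcal{B}}|$ for all $g\in\mathcal{B}^\diamond$.
   Context: All vector spaces are real and $\mathbb{R}^+$ denotes the positive reals. vv-RKBS: a Banach space $\mathcal{B}$ of functions from a set $X$ to a Banach space $\mathcal{U}$ (with pointwise vector operations) such that for every $x\in X$ there is $C_x\ge0$ with $\|f(x)\|_{\mathcal{U}}\le C_x\|f\|_{\mathcal{B}}$ for all $f\in\mathcal{B}$. Dual pair: a dual pair of Banach spaces $(E,E^\diamond)$ consists of two Banach spaces and a bilinear map $\langle\cdot,\cdot\rangle_E\colon E^\diamond\times E\to\mathbb{R}$ (the duality pairing) such that $\langle g,f\rangle_E=0$ for all $g\in E^\diamond$ implies $f=0$, and $\langle g,f\rangle_E=0$ for all $f\in E$ implies $g=0$. The dual pair (or pairing) is continuous if this bilinear map is continuous. Twin operators: for a dual pair $(\mathcal{U},\mathcal{U}^\diamond)$, $\mathrm{Twin}(\mathcal{U},\mathcal{U}^\diamond)$ is the space of bounded bilinear maps $T\colon\mathcal{U}^\diamond\times\mathcal{U}\to\mathbb{R}$ for which there are linear operators $T_{\mathcal{U}}\colon\mathcal{U}\to\mathcal{U}$ and $T_{\mathcal{U}^\diamond}\colon\mathcal{U}^\diamond\to\mathcal{U}^\diamond$ with $\langle u^\diamond,T_{\mathcal{U}}u\rangle_{\mathcal{U}}=T(u^\diamond,u)=\langle T_{\mathcal{U}^\diamond}u^\diamond,u\rangle_{\mathcal{U}}$ for all $u^\diamond\in\mathcal{U}^\diamond$, $u\in\mathcal{U}$. For $K\colon X\times\Omega\to\mathrm{Twin}(\mathcal{U},\mathcal{U}^\diamond)$,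 $K_{\mathcal{U}}(x,w)$ and $K_{\mathcal{U}^\diamond}(x,w)$ denote the two linear operators associated with $K(x,w)$. Adjoint pair of vv-RKBSs: given a dual pair $(\mathcal{U},\mathcal{U}^\diamond)$, let $\mathcal{B}$ be a vv-RKBS of functions $X\to\mathcal{U}$, $\mathcal{B}^\diamond$ a vv-RKBS of functions $\Omega\to\mathcal{U}^\diamond$, $\langle\cdot,\cdot\rangle_{\mathcal{B}}\colon\mathcal{B}^\diamond\times\mathcal{B}\to\mathbb{R}$ a continuous duality pairing and $K\colon X\times\Omega\to\mathrm{Twin}(\mathcal{U},\mathcal{U}^\diamond)$. Then $(\mathcal{B},\mathcal{B}^\diamond)$ is an adjoint pair of vv-RKBSs (adjoint vv-RKBS pair) with reproducing kernel $K$ if (i) $K_{\mathcal{U}^\diamond}(x,\cdot)u^\diamond\in\mathcal{B}^\diamond$ and $\langle u^\diamond,f(x)\rangle_{\mathcal{U}}=\langle K_{\mathcal{U}^\diamond}(x,\cdot)u^\diamond,f\rangle_{\mathcal{B}}$ for all $x\in X$, $u^\diamond\in\mathcal{U}^\diamond$, $f\in\mathcal{B}$; and (ii) $K_{\mathcal{U}}(\cdot,w)u\in\mathcal{B}$ and $\langle g(w),u\rangle_{\mathcal{U}}=\langle g,K_{\mathcal{U}}(\cdot,w)u\rangle_{\mathcal{B}}$ for all $w\in\Omega$, $u\in\mathcal{U}$, $g\in\mathcal{B}^\diamond$. Uniqueness of $K$ means: for the given pair $(\mathcal{B},\mathcal{B}^\diamond)$ and pairing $\langle\cdot,\cdot\rangle_{\mathcal{B}}$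 there is no other kernel satisfying (i) and (ii). *)

theory Defs
  imports "HOL-Analysis.Analysis" "HOL-Library.Function_Algebras"
begin

text \<open>
  The Banach spaces \<open>U\<close> and \<open>U\<^sup>\<diamond>\<close> are types of class \<^class>\<open>banach\<close>. The Banach
  spaces of functions cannot be types, since their existence is asserted inside a formula;
  they are given by a carrier \<open>E\<close> and a norm \<open>N\<close>, which is only relevant on \<open>E\<close>.
\<close>

instantiation "fun" :: (type, real_vector) real_vector
begin

definition scaleR_fun :: "real \<Rightarrow> ('a \<Rightarrow> 'b) \<Rightarrow> 'a \<Rightarrow> 'b"
  where "scaleR_fun c f = (\<lambda>x. c *\<^sub>R f x)"

instance
  by standard (simp_all add: scaleR_fun_def fun_eq_iff scaleR_add_right scaleR_add_left)

end

text \<open>The locale \<^locale>\<open>Metric_space\<close> requires nonnegativity and symmetry for all arguments,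
  not just on the carrier; hence the value 0 outside \<open>E\<close>.\<close>

definition norm_dist :: "'a::real_vector set \<Rightarrow> ('a \<Rightarrow> real) \<Rightarrow> 'a \<Rightarrow> 'a \<Rightarrow> real"
  where "norm_dist E N f g = (if f \<in> E \<and> g \<in> E then N (f - g) else 0)"

definition banach_on :: "'a::real_vector set \<Rightarrow> ('a \<Rightarrow> real) \<Rightarrow> bool"
  where "banach_on E N \<longleftrightarrow>
    subspace E \<and>
    (\<forall>f\<in>E. 0 \<le> N f) \<and>
    (\<forall>f\<in>E. N f = 0 \<longleftrightarrow> f = 0) \<and>
    (\<forall>c. \<forall>f\<in>E. N (c *\<^sub>R f) = \<bar>c\<bar> * N f) \<and>
    (\<forall>f\<in>E. \<forall>g\<in>E. N (f + g) \<le> N f + N g) \<and>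
    Metric_space.mcomplete E (norm_dist E N)"

text \<open>A function on a set \<open>X\<close> is represented by its extension by 0 to the whole type.\<close>

definition vv_RKBS :: "'x set \<Rightarrow> ('x \<Rightarrow> 'u::banach) set \<Rightarrow> (('x \<Rightarrow> 'u) \<Rightarrow> real) \<Rightarrow> bool"
  where "vv_RKBS X B N \<longleftrightarrow>
    banach_on B N \<and>
    (\<forall>f\<in>B. \<forall>x. x \<notin> X \<longrightarrow> f x = 0) \<and>
    (\<forall>x\<in>X. \<exists>C\<ge>0. \<forall>f\<in>B. norm (f x) \<le> C * N f)"

definition bilinear_on ::
    "'d::real_vector set \<Rightarrow> 'e::real_vector set \<Rightarrow> ('d \<Rightarrow> 'e \<Rightarrow> real) \<Rightarrow> bool"
  where "bilinear_on D E p \<longleftrightarrow>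
    (\<forall>g\<in>D. \<forall>f\<in>E. \<forall>f'\<in>E. p g (f + f') = p g f + p g f') \<and>
    (\<forall>g\<in>D. \<forall>c. \<forall>f\<in>E. p g (c *\<^sub>R f) = c * p g f) \<and>
    (\<forall>g\<in>D. \<forall>g'\<in>D. \<forall>f\<in>E. p (g + g') f = p g f + p g' f) \<and>
    (\<forall>c. \<forall>g\<in>D. \<forall>f\<in>E. p (c *\<^sub>R g) f = c * p g f)"

text \<open>A duality pairing \<open>p\<close> of \<open>E\<close> with \<open>D = E\<^sup>\<diamond>\<close>; as in the notation
  \<open>\<langle>g, f\<rangle>\<close>, the element of \<open>D\<close> comes first.\<close>

definition dual_pairing ::
    "'d::real_vector set \<Rightarrow> 'e::real_vector set \<Rightarrow> ('d \<Rightarrow> 'e \<Rightarrow> real) \<Rightarrow> bool"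
  where "dual_pairing D E p \<longleftrightarrow>
    bilinear_on D E p \<and>
    (\<forall>f\<in>E. (\<forall>g\<in>D. p g f = 0) \<longrightarrow> f = 0) \<and>
    (\<forall>g\<in>D. (\<forall>f\<in>E. p g f = 0) \<longrightarrow> g = 0)"

definition continuous_pairing ::
    "'d::real_vector set \<Rightarrow> ('d \<Rightarrow> real) \<Rightarrow> 'e::real_vector set \<Rightarrow> ('e \<Rightarrow> real) \<Rightarrow>
     ('d \<Rightarrow> 'e \<Rightarrow> real) \<Rightarrow> bool"
  where "continuous_pairing D ND E NE p \<longleftrightarrow>
    continuous_map
      (prod_topology (Metric_space.mtopology D (norm_dist D ND))
                     (Metric_space.mtopology E (norm_dist E NE)))
      euclideanreal (\<lambda>(g, f). p g f)"

text \<open>On whole types, the carrier-based notions are the type class ones.\<close>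

lemma norm_dist_UNIV: "norm_dist UNIV norm = (dist :: 'a::real_normed_vector \<Rightarrow> 'a \<Rightarrow> real)"
  by (simp add: norm_dist_def fun_eq_iff dist_norm)

lemma banach_on_UNIV: "banach_on UNIV (norm :: 'a::banach \<Rightarrow> real)"
  unfolding banach_on_def norm_dist_UNIV
  by (simp add: norm_triangle_ineq mcomplete_iff_complete complete_UNIV)

lemma bilinear_on_UNIV: "bilinear_on UNIV UNIV p \<longleftrightarrow> bilinear p"
  unfolding bilinear_on_def bilinear_def linear_iff by auto

lemma continuous_pairing_UNIV:
  fixes p :: "'d::real_normed_vector \<Rightarrow> 'e::real_normed_vector \<Rightarrow> real"
  shows "continuous_pairing UNIV norm UNIV norm p \<longleftrightarrow> continuous_on UNIV (\<lambda>(g, f). p g f)"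
  unfolding continuous_pairing_def norm_dist_UNIV
  by (simp add: mtopology_is_euclidean)

definition Twin :: "('ud::banach \<Rightarrow> 'u::banach \<Rightarrow> real) \<Rightarrow> ('ud \<Rightarrow> 'u \<Rightarrow> real) set"
  where "Twin pU = {T. bounded_bilinear T \<and>
    (\<exists>A A'. linear A \<and> linear A' \<and>
      (\<forall>ud u. pU ud (A u) = T ud u \<and> T ud u = pU (A' ud) u))}"

text \<open>The two operators of a twin operator; they are unique because the pairing \<open>pU\<close> is
  nondegenerate.\<close>

definition twin_op :: "('ud::banach \<Rightarrow> 'u::banach \<Rightarrow> real) \<Rightarrow> ('ud \<Rightarrow> 'u \<Rightarrow> real) \<Rightarrow> 'u \<Rightarrow> 'u"
  where "twin_op pU T = (THE A. linear A \<and> (\<forall>ud u. pU ud (A u) = T ud u))"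

definition twin_op_dual ::
    "('ud::banach \<Rightarrow> 'u::banach \<Rightarrow> real) \<Rightarrow> ('ud \<Rightarrow> 'u \<Rightarrow> real) \<Rightarrow> 'ud \<Rightarrow> 'ud"
  where "twin_op_dual pU T = (THE A'. linear A' \<and> (\<forall>ud u. T ud u = pU (A' ud) u))"

lemma twin_op:
  assumes "dual_pairing UNIV UNIV pU" and "T \<in> Twin pU"
  shows "linear (twin_op pU T)" and "pU ud (twin_op pU T u) = T ud u"
proof -
  obtain A where A: "linear A" "\<forall>ud u. pU ud (A u) = T ud u"
    using assms(2) by (auto simp: Twin_def)
  have lin: "linear (pU ud)" for ud
    using assms(1) by (auto simp: dual_pairing_def bilinear_on_UNIV bilinear_def)
  have "B = A" if "\<forall>ud u. pU ud (B u) = T ud u" for B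
  proof
    fix u
    have "pU ud (B u - A u) = 0" for ud
      using that A(2) linear_diff[OF lin] by simp
    moreover have "(\<forall>g. pU g f = 0) \<longrightarrow> f = 0" for f
      using assms(1) by (simp add: dual_pairing_def)
    ultimately have "B u - A u = 0" by blast
    then show "B u = A u" by simp
  qed
  then have "twin_op pU T = A"
    unfolding twin_op_def using A by (intro the_equality) blast+
  then show "linear (twin_op pU T)" "pU ud (twin_op pU T u) = T ud u"
    using A by auto
qed

lemma twin_op_dual:
  assumes "dual_pairing UNIV UNIV pU" and "T \<in> Twin pU"
  shows "linear (twin_op_dual pU T)" and "pU (twin_op_dual pU T ud) u = T ud u"
proof -
  obtain A where A: "linear A" "\<forall>ud u. T ud u = pU (A ud) u"
    using assms(2) by (auto simp: Twin_def)
  have lin: "linear (\<lambda>ud. pU ud u)" for u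
    using assms(1) by (auto simp: dual_pairing_def bilinear_on_UNIV bilinear_def)
  have "B = A" if "\<forall>ud u. T ud u = pU (B ud) u" for B
  proof
    fix ud
    have "pU (B ud - A ud) u = 0" for u
      using that A(2) linear_diff[OF lin[of u], of "B ud" "A ud"] by simp
    moreover have "(\<forall>f. pU g f = 0) \<longrightarrow> g = 0" for g
      using assms(1) by (simp add: dual_pairing_def)
    ultimately have "B ud - A ud = 0" by blast
    then show "B ud = A ud" by simp
  qed
  then have "twin_op_dual pU T = A"
    unfolding twin_op_dual_def using A by (intro the_equality) blast+
  then show "linear (twin_op_dual pU T)" "pU (twin_op_dual pU T ud) u = T ud u"
    using A by auto
qed

text \<open>The functions \<open>K\<^sub>U(\<cdot>, w) u\<close> on \<open>X\<close> and \<open>K\<^sub>U\<^sub>\<diamond>(x, \<cdot>) u\<^sup>\<diamond>\<close> on \<open>W\<close>,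
  where \<open>W\<close> stands for \<open>\<Omega>\<close>.\<close>

definition ker_section ::
    "('ud::banach \<Rightarrow> 'u::banach \<Rightarrow> real) \<Rightarrow> 'x set \<Rightarrow> ('x \<Rightarrow> 'w \<Rightarrow> 'ud \<Rightarrow> 'u \<Rightarrow> real) \<Rightarrow>
     'w \<Rightarrow> 'u \<Rightarrow> 'x \<Rightarrow> 'u"
  where "ker_section pU X K w u = (\<lambda>x. if x \<in> X then twin_op pU (K x w) u else 0)"

definition ker_section_dual ::
    "('ud::banach \<Rightarrow> 'u::banach \<Rightarrow> real) \<Rightarrow> 'w set \<Rightarrow> ('x \<Rightarrow> 'w \<Rightarrow> 'ud \<Rightarrow> 'u \<Rightarrow> real) \<Rightarrow>
     'x \<Rightarrow> 'ud \<Rightarrow> 'w \<Rightarrow> 'ud"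
  where "ker_section_dual pU W K x ud =
    (\<lambda>w. if w \<in> W then twin_op_dual pU (K x w) ud else 0)"

text \<open>\<open>B\<close> with norm \<open>N\<close> on \<open>X\<close>, \<open>Bd = B\<^sup>\<diamond>\<close> with norm \<open>Nd\<close> on \<open>W\<close>, and pairing \<open>pB\<close>.\<close>

definition adjoint_vv_RKBS_pair ::
    "('ud::banach \<Rightarrow> 'u::banach \<Rightarrow> real) \<Rightarrow>
     'x set \<Rightarrow> ('x \<Rightarrow> 'u) set \<Rightarrow> (('x \<Rightarrow> 'u) \<Rightarrow> real) \<Rightarrow>
     'w set \<Rightarrow> ('w \<Rightarrow> 'ud) set \<Rightarrow> (('w \<Rightarrow> 'ud) \<Rightarrow> real) \<Rightarrow>
     (('w \<Rightarrow> 'ud) \<Rightarrow> ('x \<Rightarrow> 'u) \<Rightarrow> real) \<Rightarrow>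
     ('x \<Rightarrow> 'w \<Rightarrow> 'ud \<Rightarrow> 'u \<Rightarrow> real) \<Rightarrow> bool"
  where "adjoint_vv_RKBS_pair pU X B N W Bd Nd pB K \<longleftrightarrow>
    vv_RKBS X B N \<and> vv_RKBS W Bd Nd \<and>
    dual_pairing Bd B pB \<and> continuous_pairing Bd Nd B N pB \<and>
    (\<forall>x\<in>X. \<forall>w\<in>W. K x w \<in> Twin pU) \<and>
    (\<forall>x\<in>X. \<forall>ud. ker_section_dual pU W K x ud \<in> Bd \<and>
      (\<forall>f\<in>B. pU ud (f x) = pB (ker_section_dual pU W K x ud) f)) \<and>
    (\<forall>w\<in>W. \<forall>u. ker_section pU X K w u \<in> B \<and>
      (\<forall>g\<in>Bd. pU (g w) u = pB g (ker_section pU X K w u)))"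

end

theory Submission
  imports Defs
begin

text \<open>
  For the converse, \<open>B\<close> is the closure of the span of the sections \<open>K\<^sub>U(\<cdot>, w) u\<close> in the space
  of functions \<open>f\<close> with finite weighted norm \<open>sup\<^sub>x \<parallel>f x\<parallel> / C\<^sub>X(x)\<close>. The elements of
  \<open>B\<^sup>\<diamond>\<close> are the functions \<open>g\<close> with \<open>sup\<^sub>w \<parallel>g w\<parallel> / C\<^sub>W(w)\<close> finite for which
  \<open>K\<^sub>U(\<cdot>, w) u \<mapsto> \<langle>g w, u\<rangle>\<close> extends to a bounded functional on \<open>B\<close>; this functional
  is the pairing with \<open>g\<close>, and the norm of \<open>g\<close> is the maximum of its dual norm and the
  weighted supremum. Under the additional assumptions
  \<open>\<bar>\<langle>g w, u\<rangle>\<bar> \<le> \<parallel>g\<parallel>' C\<^sub>W(w) \<parallel>u\<parallel>\<close> for the dual norm \<open>\<parallel>\<cdot>\<parallel>'\<close>, so the supremum over \<open>u\<close>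
  shows that the maximum is the dual norm.
\<close>

subsection \<open>Norms on a carrier\<close>

locale normed_carrier =
  fixes E :: "'a::real_vector set" and N :: "'a \<Rightarrow> real"
  assumes subspace: "subspace E"
    and nonneg: "f \<in> E \<Longrightarrow> 0 \<le> N f"
    and eq_0_iff: "f \<in> E \<Longrightarrow> N f = 0 \<longleftrightarrow> f = 0"
    and scale: "f \<in> E \<Longrightarrow> N (c *\<^sub>R f) = \<bar>c\<bar> * N f"
    and triangle: "f \<in> E \<Longrightarrow> g \<in> E \<Longrightarrow> N (f + g) \<le> N f + N g"
begin

lemma zero [simp]: "N 0 = 0"
  using eq_0_iff subspace subspace_0 by blast

lemma minus_commute: "f \<in> E \<Longrightarrow> g \<in> E \<Longrightarrow> N (f - g) = N (g - f)"
  using scale[of "f - g" "-1"] subspace_diff[OF subspace] by simp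

lemma triangle_diff:
  "f \<in> E \<Longrightarrow> g \<in> E \<Longrightarrow> h \<in> E \<Longrightarrow> N (f - h) \<le> N (f - g) + N (g - h)"
  using triangle[of "f - g" "g - h"] subspace_diff[OF subspace] by simp

lemma triangle_le: "f \<in> E \<Longrightarrow> g \<in> E \<Longrightarrow> N f \<le> N g + N (f - g)"
  using triangle[of g "f - g"] subspace_diff[OF subspace] by simp

lemma Metric_space: "Metric_space E (norm_dist E N)"
proof
  show "0 \<le> norm_dist E N f g" for f g
    by (simp add: norm_dist_def nonneg subspace_diff[OF subspace])
  show "norm_dist E N f g = norm_dist E N g f" for f g
    by (auto simp: norm_dist_def intro: minus_commute)
  show "norm_dist E N f g = 0 \<longleftrightarrow> f = g" if "f \<in> E" "g \<in> E" for f g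
    using that by (simp add: norm_dist_def eq_0_iff subspace_diff[OF subspace])
  show "norm_dist E N f h \<le> norm_dist E N f g + norm_dist E N g h"
    if "f \<in> E" "g \<in> E" "h \<in> E" for f g h
    using that by (simp add: norm_dist_def triangle_diff)
qed

text \<open>The completeness proofs below use this form. For sequences in \<open>E\<close> and
  limits in \<open>E\<close> the value 0 that \<open>norm_dist\<close> takes off the carrier never
  enters, so the metric is \<open>N\<close> of the difference.\<close>

lemma banach_on_iff:
  "banach_on E N \<longleftrightarrow>
    (\<forall>\<sigma> :: nat \<Rightarrow> 'a. (\<forall>n. \<sigma> n \<in> E) \<longrightarrow>
      (\<forall>e>0. \<exists>M. \<forall>m\<ge>M. \<forall>n\<ge>M. N (\<sigma> m - \<sigma> n) < e) \<longrightarrow>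
      (\<exists>f\<in>E. \<forall>e>0. \<exists>M. \<forall>n\<ge>M. N (\<sigma> n - f) < e))"
proof -
  have complete: "banach_on E N \<longleftrightarrow> Metric_space.mcomplete E (norm_dist E N)"
    unfolding banach_on_def by (simp add: subspace nonneg eq_0_iff scale triangle)
  interpret Metric_space E "norm_dist E N" by (rule Metric_space)
  have cauchy: "MCauchy \<sigma> \<longleftrightarrow> (\<forall>n. \<sigma> n \<in> E) \<and>
      (\<forall>e>0. \<exists>M. \<forall>m\<ge>M. \<forall>n\<ge>M. N (\<sigma> m - \<sigma> n) < e)" for \<sigma> :: "nat \<Rightarrow> 'a"
    unfolding MCauchy_def norm_dist_def image_subset_iff by auto
  have lim: "(\<exists>f. limitin mtopology \<sigma> f sequentially) \<longleftrightarrow>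
      (\<exists>f\<in>E. \<forall>e>0. \<exists>M. \<forall>n\<ge>M. N (\<sigma> n - f) < e)" if "\<forall>n. \<sigma> n \<in> E" for \<sigma> :: "nat \<Rightarrow> 'a"
    using that unfolding limit_metric_sequentially norm_dist_def by auto
  have "mcomplete \<longleftrightarrow> (\<forall>\<sigma> :: nat \<Rightarrow> 'a. (\<forall>n. \<sigma> n \<in> E) \<and>
      (\<forall>e>0. \<exists>M. \<forall>m\<ge>M. \<forall>n\<ge>M. N (\<sigma> m - \<sigma> n) < e) \<longrightarrow>
      (\<exists>f\<in>E. \<forall>e>0. \<exists>M. \<forall>n\<ge>M. N (\<sigma> n - f) < e))"
    unfolding mcomplete_def using cauchy lim by simp
  also have "\<dots> \<longleftrightarrow> (\<forall>\<sigma> :: nat \<Rightarrow> 'a. (\<forall>n. \<sigma> n \<in> E) \<longrightarrow>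
      (\<forall>e>0. \<exists>M. \<forall>m\<ge>M. \<forall>n\<ge>M. N (\<sigma> m - \<sigma> n) < e) \<longrightarrow>
      (\<exists>f\<in>E. \<forall>e>0. \<exists>M. \<forall>n\<ge>M. N (\<sigma> n - f) < e))"
    by (subst imp_conjL) (rule refl)
  finally show ?thesis
    unfolding complete .
qed

end

lemma banach_on_normed_carrier: "banach_on E N \<Longrightarrow> normed_carrier E N"
  by (simp add: banach_on_def normed_carrier_def)

text \<open>A Cauchy sequence in \<open>F\<close> has a limit in \<open>E\<close>, and its own terms
  are the approximations in \<open>F\<close> that \<open>closed\<close> asks for.\<close>

lemma banach_on_closed_subspace:
  fixes E F :: "'a::real_vector set"
  assumes "banach_on E N" "subspace F" "F \<subseteq> E"
    and closed: "\<And>f. f \<in> E \<Longrightarrow> (\<And>e. e > 0 \<Longrightarrow> \<exists>h\<in>F. N (h - f) < e) \<Longrightarrow> f \<in> F"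
  shows "banach_on F N"
proof -
  interpret E: normed_carrier E N
    using assms(1) by (rule banach_on_normed_carrier)
  interpret F: normed_carrier F N
    using assms(2,3) E.nonneg E.eq_0_iff E.scale E.triangle
    by (simp add: normed_carrier_def subset_iff)
  show ?thesis
    unfolding F.banach_on_iff
  proof (intro allI impI)
    fix \<sigma> :: "nat \<Rightarrow> 'a" assume \<sigma>: "\<forall>n. \<sigma> n \<in> F" "\<forall>e>0. \<exists>M. \<forall>m\<ge>M. \<forall>n\<ge>M. N (\<sigma> m - \<sigma> n) < e"
    then obtain f where f: "f \<in> E" "\<forall>e>0. \<exists>M. \<forall>n\<ge>M. N (\<sigma> n - f) < e"
      using spec[OF assms(1)[unfolded E.banach_on_iff], of \<sigma>] \<open>F \<subseteq> E\<close> by auto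
    moreover have "f \<in> F"
    proof (rule closed[OF f(1)])
      show "\<exists>h\<in>F. N (h - f) < e" if "e > 0" for e
        using f(2) \<sigma>(1) that by blast
    qed
    ultimately show "\<exists>f\<in>F. \<forall>e>0. \<exists>M. \<forall>n\<ge>M. N (\<sigma> n - f) < e" by blast
  qed
qed

text \<open>Expanding \<open>p (g0 + a) (f0 + b)\<close> by bilinearity leaves three error terms,
  each at most a product of norms, so all of them vanish as \<open>a\<close> and \<open>b\<close>
  tend to 0.\<close>

lemma continuous_pairingI:
  assumes "normed_carrier D ND" "normed_carrier E NE"
    and bil: "bilinear_on D E p"
    and bound: "\<And>g f. g \<in> D \<Longrightarrow> f \<in> E \<Longrightarrow> \<bar>p g f\<bar> \<le> ND g * NE f"
  shows "continuous_pairing D ND E NE p"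
proof -
  interpret D: normed_carrier D ND by fact
  interpret E: normed_carrier E NE by fact
  interpret MD: Metric_space D "norm_dist D ND" by (rule D.Metric_space)
  interpret ME: Metric_space E "norm_dist E NE" by (rule E.Metric_space)
  have near: "\<exists>d>0. \<forall>g\<in>D. \<forall>f\<in>E. ND (g0 - g) < d \<longrightarrow> NE (f0 - f) < d \<longrightarrow> \<bar>p g f - p g0 f0\<bar> < e"
    if "g0 \<in> D" "f0 \<in> E" "e > 0" for g0 f0 e
  proof -
    \<comment> \<open>Since \<open>d \<le> 1\<close>, the quadratic term is at most
      \<open>d\<close>, and the total error is at most \<open>d * (ND g0 + NE f0 + 1)\<close>. The 2
      in place of 1 makes the final estimate strict.\<close>
    define d where "d = min 1 (e / (ND g0 + NE f0 + 2))"
    have pos: "ND g0 + NE f0 + 2 > 0"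
      using D.nonneg[OF that(1)] E.nonneg[OF that(2)] by simp
    have "d \<le> e / (ND g0 + NE f0 + 2)" by (simp add: d_def)
    then have "d * (ND g0 + NE f0 + 2) \<le> e"
      using pos by (simp only: pos_le_divide_eq)
    then have d: "d > 0" "d \<le> 1" "d * (ND g0 + NE f0 + 2) \<le> e"
      using that(3) pos by (simp_all add: d_def)
    have "\<bar>p g f - p g0 f0\<bar> < e"
      if g: "g \<in> D" "ND (g0 - g) < d" and f: "f \<in> E" "NE (f0 - f) < d" for g f
    proof -
      define a where "a = g - g0"
      define b where "b = f - f0"
      have ab: "a \<in> D" "b \<in> E" "ND a < d" "NE b < d"
        using g f \<open>g0 \<in> D\<close> \<open>f0 \<in> E\<close> D.minus_commute[of g g0] E.minus_commute[of f f0]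
          subspace_diff[OF D.subspace] subspace_diff[OF E.subspace]
        by (auto simp: a_def b_def)
      have "p g f = p (g0 + a) (f0 + b)"
        by (simp add: a_def b_def)
      also have "\<dots> = p g0 f0 + p g0 b + p a f0 + p a b"
        using bil ab \<open>g0 \<in> D\<close> \<open>f0 \<in> E\<close> subspace_add[OF E.subspace]
        unfolding bilinear_on_def by simp
      finally have "\<bar>p g f - p g0 f0\<bar> \<le> ND g0 * NE b + ND a * NE f0 + ND a * NE b"
        using bound[OF \<open>g0 \<in> D\<close> ab(2)] bound[OF ab(1) \<open>f0 \<in> E\<close>] bound[OF ab(1,2)] by linarith
      also have "\<dots> \<le> ND g0 * d + d * NE f0 + d * 1"
        using ab d D.nonneg[OF that(1)] E.nonneg[OF that(3)] \<open>g0 \<in> D\<close> \<open>f0 \<in> E\<close>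
        by (intro add_mono mult_mono) (auto intro: D.nonneg E.nonneg)
      also have "\<dots> < d * (ND g0 + NE f0 + 2)"
        using d(1) by (simp add: algebra_simps)
      finally show ?thesis using d(3) by simp
    qed
    then show ?thesis using d(1) by blast
  qed
  show ?thesis
    unfolding continuous_pairing_def continuous_map_def
  proof (intro conjI allI impI)
    fix U assume U: "openin euclideanreal U"
    show "openin (prod_topology MD.mtopology ME.mtopology)
        {x \<in> topspace (prod_topology MD.mtopology ME.mtopology). (case x of (g, f) \<Rightarrow> p g f) \<in> U}"
      unfolding openin_prod_topology_alt
    proof (intro allI impI)
      fix g0 f0
      assume "(g0, f0) \<in> {x \<in> topspace (prod_topology MD.mtopology ME.mtopology).
          (case x of (g, f) \<Rightarrow> p g f) \<in> U}"
      then have 0: "g0 \<in> D" "f0 \<in> E" "p g0 f0 \<in> U" by auto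
      then obtain e where e: "e > 0" "\<And>r. \<bar>r - p g0 f0\<bar> < e \<Longrightarrow> r \<in> U"
        using U by (auto simp: open_dist dist_real_def)
      obtain d where d: "d > 0"
        "\<And>g f. g \<in> D \<Longrightarrow> f \<in> E \<Longrightarrow> ND (g0 - g) < d \<Longrightarrow> NE (f0 - f) < d \<Longrightarrow> \<bar>p g f - p g0 f0\<bar> < e"
        using near[OF 0(1,2) e(1)] by blast
      show "\<exists>V V'. openin MD.mtopology V \<and> openin ME.mtopology V' \<and> g0 \<in> V \<and> f0 \<in> V' \<and>
          V \<times> V' \<subseteq> {x \<in> topspace (prod_topology MD.mtopology ME.mtopology).
            (case x of (g, f) \<Rightarrow> p g f) \<in> U}"
        using 0 d e by (intro exI[of _ "MD.mball g0 d"] exI[of _ "ME.mball f0 d"])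
          (auto simp: norm_dist_def)
    qed
  qed auto
qed

subsection \<open>Norms defined by a family of seminorms\<close>

text \<open>Both \<open>sup.space\<close> and \<open>dual.space\<close> below are instances.
  Completeness is asked seminorm by seminorm, without uniformity in \<open>i\<close>, so that
  pointwise limits suffice to check it. A weight \<open>q i\<close> may be 0, which forces
  \<open>p i f = 0\<close> for all \<open>f\<close> in the resulting space.\<close>

locale seminorm_family =
  fixes V :: "'a::real_vector set" and I :: "'i set"
    and p :: "'i \<Rightarrow> 'a \<Rightarrow> real" and q :: "'i \<Rightarrow> real"
  assumes subspace_V: "subspace V"
    and p_triangle: "i \<in> I \<Longrightarrow> f \<in> V \<Longrightarrow> g \<in> V \<Longrightarrow> p i (f + g) \<le> p i f + p i g"
    and p_scale: "i \<in> I \<Longrightarrow> f \<in> V \<Longrightarrow> p i (c *\<^sub>R f) = \<bar>c\<bar> * p i f"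
    and p_definite: "f \<in> V \<Longrightarrow> (\<And>i. i \<in> I \<Longrightarrow> p i f = 0) \<Longrightarrow> f = 0"
    and q_nonneg: "i \<in> I \<Longrightarrow> 0 \<le> q i"
    and p_complete: "\<And>\<sigma> :: nat \<Rightarrow> 'a. (\<And>n. \<sigma> n \<in> V) \<Longrightarrow>
      (\<And>i e. i \<in> I \<Longrightarrow> e > 0 \<Longrightarrow> \<exists>M. \<forall>m\<ge>M. \<forall>n\<ge>M. p i (\<sigma> m - \<sigma> n) < e) \<Longrightarrow>
      \<exists>f\<in>V. \<forall>i\<in>I. (\<lambda>n. p i (\<sigma> n - f)) \<longlonglongrightarrow> 0"
begin

text \<open>The condition \<open>0 \<le> C\<close> keeps the set of bounds bounded below even if
  \<open>I\<close> is empty or all weights vanish.\<close>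

definition bounded_by :: "real \<Rightarrow> 'a \<Rightarrow> bool"
  where "bounded_by C f \<longleftrightarrow> 0 \<le> C \<and> (\<forall>i\<in>I. p i f \<le> C * q i)"

definition space :: "'a set"
  where "space = {f \<in> V. \<exists>C. bounded_by C f}"

text \<open>In effect the supremum of the quotients \<open>p i f / q i\<close>, written as an
  infimum of bounds because \<open>q i\<close> may be 0.\<close>

definition gauge :: "'a \<Rightarrow> real"
  where "gauge f = Inf {C. bounded_by C f}"

lemma spaceI: "f \<in> V \<Longrightarrow> bounded_by C f \<Longrightarrow> f \<in> space"
  by (auto simp: space_def)

lemma space_V: "f \<in> space \<Longrightarrow> f \<in> V"
  by (simp add: space_def)

lemma gauge_le: "bounded_by C f \<Longrightarrow> gauge f \<le> C"
  unfolding gauge_def by (rule cInf_lower) (auto simp: bounded_by_def intro: bdd_belowI[of _ 0])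

text \<open>The infimum is attained: where \<open>q i > 0\<close>, every bound is at least
  \<open>p i f / q i\<close>; where \<open>q i = 0\<close>, the inequality does not depend on the
  bound.\<close>

lemma gauge_bounded_by:
  assumes "f \<in> space"
  shows "bounded_by (gauge f) f"
proof -
  have ne: "{C. bounded_by C f} \<noteq> {}"
    using assms by (auto simp: space_def)
  have "p i f \<le> gauge f * q i" if i: "i \<in> I" for i
  proof (cases "q i = 0")
    case True
    then show ?thesis
      using ne i by (auto simp: bounded_by_def)
  next
    case False
    then have "q i > 0" using q_nonneg[OF i] by simp
    then have "p i f / q i \<le> gauge f"
      unfolding gauge_def using ne i
      by (intro cInf_greatest) (auto simp: bounded_by_def field_simps)
    then show ?thesis using \<open>q i > 0\<close> by (simp add: field_simps)
  qed
  moreover have "0 \<le> gauge f"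
    unfolding gauge_def using ne by (intro cInf_greatest) (auto simp: bounded_by_def)
  ultimately show ?thesis by (simp add: bounded_by_def)
qed

lemma p_le_gauge: "f \<in> space \<Longrightarrow> i \<in> I \<Longrightarrow> p i f \<le> gauge f * q i"
  using gauge_bounded_by by (simp add: bounded_by_def)

lemma gauge_nonneg: "f \<in> space \<Longrightarrow> 0 \<le> gauge f"
  using gauge_bounded_by by (simp add: bounded_by_def)

lemma p_0: "i \<in> I \<Longrightarrow> p i 0 = 0"
  using p_scale[of i 0 0] subspace_0[OF subspace_V] by simp

text \<open>The triangle inequality for \<open>f\<close> and its negative gives
  \<open>0 \<le> 2 * p i f\<close>.\<close>

lemma p_nonneg:
  assumes "i \<in> I" "f \<in> V"
  shows "0 \<le> p i f"
  using p_triangle[OF assms, of "(-1) *\<^sub>R f"] p_scale[OF assms, of "-1"] p_0[OF assms(1)]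
    subspace_neg[OF subspace_V assms(2)] by simp

lemma bounded_by_add:
  assumes "f \<in> V" "g \<in> V" "bounded_by C f" "bounded_by D g"
  shows "bounded_by (C + D) (f + g)"
  unfolding bounded_by_def
proof (intro conjI ballI)
  show "0 \<le> C + D" using assms by (simp add: bounded_by_def)
  show "p i (f + g) \<le> (C + D) * q i" if "i \<in> I" for i
    using p_triangle[OF that assms(1,2)] assms(3,4) that
    by (fastforce simp: bounded_by_def distrib_right)
qed

lemma bounded_by_scale:
  assumes "f \<in> V" "bounded_by C f"
  shows "bounded_by (\<bar>c\<bar> * C) (c *\<^sub>R f)"
  using assms(2) p_scale[OF _ assms(1)]
  by (simp add: bounded_by_def mult.assoc mult_left_mono)

lemma subspace_space: "subspace space"
proof (rule subspaceI)
  show "0 \<in> space"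
    using subspace_0[OF subspace_V] by (intro spaceI[of _ 0]) (auto simp: bounded_by_def p_0)
  show "f + g \<in> space" if "f \<in> space" "g \<in> space" for f g
    using that bounded_by_add subspace_add[OF subspace_V] unfolding space_def by blast
  show "c *\<^sub>R f \<in> space" if "f \<in> space" for f c
    using that bounded_by_scale subspace_scale[OF subspace_V] unfolding space_def by blast
qed

sublocale normed_carrier space gauge
proof
  show "subspace space" by (rule subspace_space)
  show "0 \<le> gauge f" if "f \<in> space" for f
    using that by (rule gauge_nonneg)
  show "gauge f = 0 \<longleftrightarrow> f = 0" if "f \<in> space" for f
  proof
    assume 0: "gauge f = 0"
    have "p i f = 0" if "i \<in> I" for i
      using p_le_gauge[OF \<open>f \<in> space\<close> that] p_nonneg[OF that] space_V[OF \<open>f \<in> space\<close>] 0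
      by (simp add: order.antisym)
    then show "f = 0" using p_definite space_V[OF that] by blast
  next
    assume "f = 0"
    then have "bounded_by 0 f" by (simp add: bounded_by_def p_0)
    then show "gauge f = 0" using gauge_le gauge_nonneg[OF that] by fastforce
  qed
  show "gauge (f + g) \<le> gauge f + gauge g" if "f \<in> space" "g \<in> space" for f g
    using that by (intro gauge_le bounded_by_add gauge_bounded_by space_V)
  have le: "gauge (c *\<^sub>R f) \<le> \<bar>c\<bar> * gauge f" if "f \<in> space" for c f
    using that by (intro gauge_le bounded_by_scale gauge_bounded_by space_V)
  show "gauge (c *\<^sub>R f) = \<bar>c\<bar> * gauge f" if f: "f \<in> space" for c f
  proof (cases "c = 0")
    case True
    then show ?thesis
      using le[OF f, of c] gauge_nonneg[OF subspace_0[OF subspace_space]] by simp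
  next
    case False
    \<comment> \<open>The reverse inequality is \<open>le\<close> for the vector multiplied by
      \<open>c\<close>, scaled back by \<open>inverse c\<close>.\<close>
    have "gauge f \<le> \<bar>inverse c\<bar> * gauge (c *\<^sub>R f)"
      using le[OF subspace_scale[OF subspace_space f], of "inverse c" c] False by simp
    then have "\<bar>c\<bar> * gauge f \<le> gauge (c *\<^sub>R f)"
      using False by (simp add: field_simps abs_inverse)
    then show ?thesis using le[OF f, of c] by simp
  qed
qed

text \<open>A Cauchy sequence for the gauge is Cauchy in every seminorm and so has a limit
  \<open>f\<close> there. Letting \<open>m\<close> tend to infinity in the bounds on
  \<open>\<sigma> n - \<sigma> m\<close> gives the same bounds on \<open>\<sigma> n - f\<close>,
  uniformly in \<open>i\<close>; these yield both \<open>f \<in> space\<close> and convergence in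
  the gauge.\<close>

lemma banach_on_space: "banach_on space gauge"
  unfolding banach_on_iff
proof (intro allI impI)
  fix \<sigma> :: "nat \<Rightarrow> 'a"
  assume \<sigma>: "\<forall>n. \<sigma> n \<in> space"
    and cauchy: "\<forall>e>0. \<exists>M. \<forall>m\<ge>M. \<forall>n\<ge>M. gauge (\<sigma> m - \<sigma> n) < e"
  have diff: "\<sigma> m - \<sigma> n \<in> space" for m n
    using \<sigma> subspace_diff[OF subspace_space] by blast
  have "\<exists>M. \<forall>m\<ge>M. \<forall>n\<ge>M. p i (\<sigma> m - \<sigma> n) < e" if i: "i \<in> I" and e: "e > 0" for i e
  proof -
    \<comment> \<open>Dividing by \<open>q i + 1\<close> rather than \<open>q i\<close> covers
      vanishing weights.\<close>
    have q1: "q i + 1 > 0" using q_nonneg[OF i] by simp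
    then obtain M where M: "\<And>m n. m \<ge> M \<Longrightarrow> n \<ge> M \<Longrightarrow> gauge (\<sigma> m - \<sigma> n) < e / (q i + 1)"
      using cauchy e by (meson divide_pos_pos)
    have "p i (\<sigma> m - \<sigma> n) < e" if "m \<ge> M" "n \<ge> M" for m n
    proof -
      have "p i (\<sigma> m - \<sigma> n) \<le> gauge (\<sigma> m - \<sigma> n) * (q i + 1)"
        using p_le_gauge[OF diff i, of m n] gauge_nonneg[OF diff, of m n] by (simp add: distrib_left)
      also have "\<dots> < e" using M[OF that] q1 by (simp add: field_simps)
      finally show ?thesis .
    qed
    then show ?thesis by blast
  qed
  then obtain f where f: "f \<in> V" "\<And>i. i \<in> I \<Longrightarrow> (\<lambda>n. p i (\<sigma> n - f)) \<longlonglongrightarrow> 0"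
    using p_complete[of \<sigma>] \<sigma> space_V by metis
  have diff_V: "\<sigma> n - f \<in> V" for n
    using \<sigma> f(1) space_V subspace_diff[OF subspace_V] by blast
  have lim: "bounded_by e (\<sigma> n - f)"
    if e: "e > 0" and n: "n \<ge> M" and M: "\<forall>m\<ge>M. \<forall>n\<ge>M. gauge (\<sigma> m - \<sigma> n) < e" for e n M
    unfolding bounded_by_def
  proof (intro conjI ballI)
    fix i assume i: "i \<in> I"
    have "p i (\<sigma> n - f) \<le> e * q i + p i (\<sigma> m - f)" if "m \<ge> M" for m
    proof -
      have "p i (\<sigma> n - f) \<le> p i (\<sigma> n - \<sigma> m) + p i (\<sigma> m - f)"
        using p_triangle[OF i space_V[OF diff] diff_V, of n m m] by simp
      also have "p i (\<sigma> n - \<sigma> m) \<le> e * q i"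
        using p_le_gauge[OF diff i, of n m] M n that
        by (meson less_imp_le mult_right_mono order_trans q_nonneg[OF i])
      finally show ?thesis by simp
    qed
    moreover have "(\<lambda>m. e * q i + p i (\<sigma> m - f)) \<longlonglongrightarrow> e * q i + 0"
      using f(2)[OF i] by (intro tendsto_intros)
    ultimately have "p i (\<sigma> n - f) \<le> e * q i + 0"
      by (intro LIMSEQ_le_const[of "\<lambda>m. e * q i + p i (\<sigma> m - f)"]) blast+
    then show "p i (\<sigma> n - f) \<le> e * q i" by simp
  qed (use e in simp)
  have "f \<in> space"
  proof -
    obtain M where "\<forall>m\<ge>M. \<forall>n\<ge>M. gauge (\<sigma> m - \<sigma> n) < 1"
      using cauchy zero_less_one by blast
    then have "\<sigma> M - f \<in> space"
      using lim[of 1 M M] diff_V by (auto intro: spaceI)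
    then show ?thesis
      using \<sigma> subspace_diff[OF subspace_space, of "\<sigma> M" "\<sigma> M - f"] by simp
  qed
  moreover have "\<exists>M. \<forall>n\<ge>M. gauge (\<sigma> n - f) < e" if "e > 0" for e
  proof -
    \<comment> \<open>The limit only preserves a weak inequality, so \<open>e / 2\<close> is used to
      end with a strict one.\<close>
    obtain M where "\<forall>m\<ge>M. \<forall>n\<ge>M. gauge (\<sigma> m - \<sigma> n) < e / 2"
      using spec[OF cauchy, of "e / 2"] \<open>e > 0\<close> by auto
    then have "gauge (\<sigma> n - f) < e" if "n \<ge> M" for n
      using gauge_le[OF lim[OF _ that, of "e / 2"]] \<open>e > 0\<close> by simp
    then show ?thesis by blast
  qed
  ultimately show "\<exists>f\<in>space. \<forall>e>0. \<exists>M. \<forall>n\<ge>M. gauge (\<sigma> n - f) < e" by blast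
qed

end

section \<open>Pointwise limits of functions into a Banach space\<close>

lemma pointwise_limit_exists:
  fixes \<sigma> :: "nat \<Rightarrow> 'x \<Rightarrow> 'u::banach"
  assumes "\<And>x e. x \<in> X \<Longrightarrow> e > 0 \<Longrightarrow> \<exists>M. \<forall>m\<ge>M. \<forall>n\<ge>M. norm (\<sigma> m x - \<sigma> n x) < e"
  shows "\<exists>f. (\<forall>x. x \<notin> X \<longrightarrow> f x = 0) \<and> (\<forall>x\<in>X. (\<lambda>n. \<sigma> n x) \<longlonglongrightarrow> f x)"
proof -
  have "convergent (\<lambda>n. \<sigma> n x)" if "x \<in> X" for x
    using assms[OF that] by (intro Cauchy_convergent CauchyI) blast
  \<comment> \<open>The value 0 outside \<open>X\<close> makes the limit the representative of a
    function on \<open>X\<close>.\<close>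
  then show ?thesis
    by (intro exI[of _ "\<lambda>x. if x \<in> X then lim (\<lambda>n. \<sigma> n x) else 0"])
      (auto simp: convergent_LIMSEQ_iff)
qed

lemma subspace_vanishing: "subspace {f :: 'x \<Rightarrow> 'u::real_vector. \<forall>x. x \<notin> X \<longrightarrow> f x = 0}"
  by (auto simp: subspace_def scaleR_fun_def)

subsection \<open>The adjoint pair of a bounded kernel\<close>

text \<open>The setting of the converse. The bounding functions of two arguments enter as one
  constant for each fixed pair, while \<open>CX\<close> and \<open>CW\<close> are fixed because they
  serve as weights of the norms.\<close>

locale bounded_twin_kernel =
  fixes pU :: "'ud::banach \<Rightarrow> 'u::banach \<Rightarrow> real"
    and X :: "'x set" and W :: "'w set"
    and K :: "'x \<Rightarrow> 'w \<Rightarrow> 'ud \<Rightarrow> 'u \<Rightarrow> real"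
    and CX :: "'x \<Rightarrow> real" and CW :: "'w \<Rightarrow> real"
  assumes dual: "dual_pairing UNIV UNIV pU"
    and cont: "continuous_pairing UNIV norm UNIV norm pU"
    and twin: "x \<in> X \<Longrightarrow> w \<in> W \<Longrightarrow> K x w \<in> Twin pU"
    and CX_pos: "x \<in> X \<Longrightarrow> 0 < CX x" and CW_pos: "w \<in> W \<Longrightarrow> 0 < CW w"
    and bound: "w \<in> W \<Longrightarrow> \<exists>C\<ge>0. \<forall>x\<in>X. norm (twin_op pU (K x w) u) \<le> C * CX x"
    and bound_dual: "x \<in> X \<Longrightarrow> \<exists>C\<ge>0. \<forall>w\<in>W. norm (twin_op_dual pU (K x w) ud) \<le> C * CW w"
begin

section \<open>Linearity and continuity of the pairing on \<open>U\<close>\<close>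

lemma linear_left: "linear (\<lambda>ud. pU ud u)" and linear_right: "linear (pU ud)"
  using dual by (auto simp: dual_pairing_def bilinear_on_UNIV bilinear_def)

lemma pU_eq_0_right: "(\<And>ud. pU ud u = 0) \<Longrightarrow> u = 0"
  and pU_eq_0_left: "(\<And>u. pU ud u = 0) \<Longrightarrow> ud = 0"
  using dual by (auto simp: dual_pairing_def)

lemma continuous_on_pU: "continuous_on UNIV (\<lambda>(ud, u). pU ud u)"
  using cont by (simp add: continuous_pairing_UNIV)

lemma tendsto_pU:
  assumes "(a \<longlongrightarrow> ud) F" "(b \<longlongrightarrow> u) F"
  shows "((\<lambda>n. pU (a n) (b n)) \<longlongrightarrow> pU ud u) F"
  using continuous_on_tendsto_compose[OF continuous_on_pU tendsto_Pair[OF assms]] by simp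

text \<open>Continuity at 0 bounds the functional on a ball, and homogeneity carries the bound to
  all \<open>u\<close>.\<close>

lemma pU_bounded_right: "\<exists>C\<ge>0. \<forall>u. \<bar>pU ud u\<bar> \<le> C * norm u"
proof -
  have "isCont (pU ud) 0"
    unfolding isCont_def by (rule tendsto_pU) (auto intro: tendsto_intros)
  then obtain d where d: "d > 0" "\<And>u. norm u < d \<Longrightarrow> \<bar>pU ud u\<bar> < 1"
    unfolding continuous_at_eps_delta dist_norm
    by (metis diff_zero linear_0[OF linear_right] real_norm_def zero_less_one)
  have "\<bar>pU ud u\<bar> \<le> 2 / d * norm u" for u
  proof (cases "u = 0")
    case False
    \<comment> \<open>This scales \<open>u\<close> to norm \<open>d / 2\<close>, strictly inside the
      ball of radius \<open>d\<close>.\<close>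
    define c where "c = d / (2 * norm u)"
    have c: "c > 0" "norm (c *\<^sub>R u) < d"
      using d(1) False by (auto simp: c_def)
    have "c * \<bar>pU ud u\<bar> < 1"
      using d(2)[OF c(2)] c(1) by (simp add: linear_scale[OF linear_right] abs_mult)
    then show ?thesis
      using d(1) False by (simp add: c_def field_simps)
  qed (simp add: linear_0[OF linear_right])
  then show ?thesis using d(1) by (intro exI[of _ "2 / d"]) auto
qed

section \<open>Kernel sections and their linear combinations\<close>

abbreviation sec :: "'w \<Rightarrow> 'u \<Rightarrow> 'x \<Rightarrow> 'u"
  where "sec \<equiv> ker_section pU X K"

abbreviation sec_dual :: "'x \<Rightarrow> 'ud \<Rightarrow> 'w \<Rightarrow> 'ud"
  where "sec_dual \<equiv> ker_section_dual pU W K"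

lemma sec_scale: "w \<in> W \<Longrightarrow> sec w (c *\<^sub>R u) = c *\<^sub>R sec w u"
  using linear_scale[OF twin_op(1)[OF dual twin]]
  by (auto simp: ker_section_def scaleR_fun_def fun_eq_iff)

text \<open>Linear combinations of the sections are encoded by lists of pairs \<open>(w, u)\<close>, with the
  coefficients absorbed into \<open>u\<close>.\<close>

definition combs :: "('w \<times> 'u) list set"
  where "combs = {l. set l \<subseteq> W \<times> UNIV}"

definition comb :: "('w \<times> 'u) list \<Rightarrow> 'x \<Rightarrow> 'u"
  where "comb l = (\<Sum>(w, u)\<leftarrow>l. sec w u)"

text \<open>The value that the functional of \<open>g\<close> must take at \<open>comb l\<close>. It
  is a function of the list because different lists may have the same \<open>comb\<close>, and for
  arbitrary \<open>g\<close> the values may then differ.\<close>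

definition pair_comb :: "('w \<Rightarrow> 'ud) \<Rightarrow> ('w \<times> 'u) list \<Rightarrow> real"
  where "pair_comb g l = (\<Sum>(w, u)\<leftarrow>l. pU (g w) u)"

definition scale_comb :: "real \<Rightarrow> ('w \<times> 'u) list \<Rightarrow> ('w \<times> 'u) list"
  where "scale_comb c l = map (\<lambda>(w, u). (w, c *\<^sub>R u)) l"

lemma combs_simps [simp]:
  "[] \<in> combs" "(w, u) # l \<in> combs \<longleftrightarrow> w \<in> W \<and> l \<in> combs"
  "l @ l' \<in> combs \<longleftrightarrow> l \<in> combs \<and> l' \<in> combs"
  by (auto simp: combs_def)

lemma scale_comb_combs [simp]: "l \<in> combs \<Longrightarrow> scale_comb c l \<in> combs"
  by (auto simp: combs_def scale_comb_def)

lemma comb_simps [simp]: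
  "comb [] = 0" "comb ((w, u) # l) = sec w u + comb l" "comb (l @ l') = comb l + comb l'"
  by (auto simp: comb_def)

lemma pair_comb_simps [simp]:
  "pair_comb g [] = 0" "pair_comb g ((w, u) # l) = pU (g w) u + pair_comb g l"
  "pair_comb g (l @ l') = pair_comb g l + pair_comb g l'"
  by (auto simp: pair_comb_def)

lemma comb_scale: "l \<in> combs \<Longrightarrow> comb (scale_comb c l) = c *\<^sub>R comb l"
  by (induction l) (auto simp: scale_comb_def sec_scale scaleR_add_right)

lemma pair_comb_scale: "pair_comb g (scale_comb c l) = c * pair_comb g l"
  by (induction l)
    (auto simp: scale_comb_def linear_scale[OF linear_right] distrib_left)

lemma pair_comb_add_left: "pair_comb (g + h) l = pair_comb g l + pair_comb h l"
  by (induction l) (auto simp: linear_add[OF linear_left])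

lemma pair_comb_scale_left: "pair_comb (c *\<^sub>R g) l = c * pair_comb g l"
  by (induction l) (auto simp: scaleR_fun_def linear_scale[OF linear_left] distrib_left)

lemma pair_comb_tendsto:
  "l \<in> combs \<Longrightarrow> (\<And>w. w \<in> W \<Longrightarrow> (\<lambda>n. \<sigma> n w) \<longlonglongrightarrow> g w) \<Longrightarrow>
    (\<lambda>n. pair_comb (\<sigma> n) l) \<longlonglongrightarrow> pair_comb g l"
  by (induction l) (auto intro!: tendsto_add tendsto_pU)

text \<open>Both sides are the sum of \<open>K x w ud u\<close> over the list, since the two
  operators of a twin operator represent the same bilinear map.\<close>

lemma pair_comb_sec_dual:
  assumes "x \<in> X"
  shows "l \<in> combs \<Longrightarrow> pair_comb (sec_dual x ud) l = pU ud (comb l x)"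
  using assms
  by (induction l) (auto simp: linear_0[OF linear_right] linear_add[OF linear_right]
      ker_section_def ker_section_dual_def twin_op(2)[OF dual twin] twin_op_dual(2)[OF dual twin])

section \<open>The Banach space \<open>B\<close>\<close>

sublocale sup: seminorm_family "{f :: 'x \<Rightarrow> 'u. \<forall>x. x \<notin> X \<longrightarrow> f x = 0}" X "\<lambda>x f. norm (f x)" CX
proof
  fix \<sigma> :: "nat \<Rightarrow> 'x \<Rightarrow> 'u"
  assume "\<And>x e. x \<in> X \<Longrightarrow> e > 0 \<Longrightarrow> \<exists>M. \<forall>m\<ge>M. \<forall>n\<ge>M. norm ((\<sigma> m - \<sigma> n) x) < e"
  then obtain f where "\<forall>x. x \<notin> X \<longrightarrow> f x = 0" "\<forall>x\<in>X. (\<lambda>n. \<sigma> n x) \<longlonglongrightarrow> f x"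
    using pointwise_limit_exists[of X \<sigma>] by auto
  then show "\<exists>f\<in>{f. \<forall>x. x \<notin> X \<longrightarrow> f x = 0}. \<forall>x\<in>X. (\<lambda>n. norm ((\<sigma> n - f) x)) \<longlonglongrightarrow> 0"
    by (auto intro!: exI[of _ f] tendsto_norm_zero LIM_zero)
next
  fix f :: "'x \<Rightarrow> 'u"
  assume "f \<in> {f. \<forall>x. x \<notin> X \<longrightarrow> f x = 0}" "\<And>x. x \<in> X \<Longrightarrow> norm (f x) = 0"
  then show "f = 0" by (fastforce simp: fun_eq_iff)
qed (auto simp: subspace_vanishing scaleR_fun_def norm_triangle_ineq less_imp_le[OF CX_pos])

lemma sec_sup: "w \<in> W \<Longrightarrow> sec w u \<in> sup.space"
  using bound[of w u] by (auto simp: sup.space_def sup.bounded_by_def ker_section_def)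

lemma comb_sup: "l \<in> combs \<Longrightarrow> comb l \<in> sup.space"
  by (induction l)
    (auto intro!: sec_sup subspace_0[OF sup.subspace] subspace_add[OF sup.subspace])

definition B :: "('x \<Rightarrow> 'u) set"
  where "B = {f \<in> sup.space. \<forall>e>0. \<exists>l\<in>combs. sup.gauge (f - comb l) < e}"

abbreviation N :: "('x \<Rightarrow> 'u) \<Rightarrow> real"
  where "N \<equiv> sup.gauge"

lemma B_sup: "f \<in> B \<Longrightarrow> f \<in> sup.space"
  by (simp add: B_def)

text \<open>The sequence consists of lists, not of functions, so that \<open>pair_comb g\<close> can
  be applied to its terms; the pairing will be the limit of these values.\<close>

definition approximates :: "(nat \<Rightarrow> ('w \<times> 'u) list) \<Rightarrow> ('x \<Rightarrow> 'u) \<Rightarrow> bool"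
  where "approximates L f \<longleftrightarrow> (\<forall>n. L n \<in> combs) \<and> (\<lambda>n. N (f - comb (L n))) \<longlonglongrightarrow> 0"

lemma B_approximates: "f \<in> B \<Longrightarrow> \<exists>L. approximates L f"
proof -
  assume f: "f \<in> B"
  then have "\<exists>l\<in>combs. N (f - comb l) < 1 / Suc n" for n
    by (simp add: B_def)
  then obtain L where L: "\<And>n. L n \<in> combs" "\<And>n. N (f - comb (L n)) < 1 / Suc n"
    by metis
  have "f - comb (L n) \<in> sup.space" for n
    using f L(1) by (intro subspace_diff[OF sup.subspace] B_sup comb_sup)
  then have "(\<lambda>n. N (f - comb (L n))) \<longlonglongrightarrow> 0"
    using L(2) by (intro tendsto_sandwich[OF _ _ tendsto_const LIMSEQ_inverse_real_of_nat])
      (auto simp: inverse_eq_divide sup.nonneg less_imp_le)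
  then show ?thesis using L(1) by (auto simp: approximates_def)
qed

lemma approximates_B:
  assumes "f \<in> sup.space" "approximates L f"
  shows "f \<in> B"
proof -
  have "\<exists>l\<in>combs. N (f - comb l) < e" if "e > 0" for e
  proof -
    have "\<forall>\<^sub>F n in sequentially. N (f - comb (L n)) < e"
      using assms(2) that by (auto simp: approximates_def intro: order_tendstoD(2))
    then obtain n where "N (f - comb (L n)) < e"
      by (auto simp: eventually_sequentially)
    then show ?thesis using assms(2) by (auto simp: approximates_def)
  qed
  then show ?thesis using assms(1) by (simp add: B_def)
qed

lemma approximates_const: "l \<in> combs \<Longrightarrow> approximates (\<lambda>_. l) (comb l)"
  by (simp add: approximates_def)

lemma approximates_add:
  assumes "approximates L f" "approximates L' f'" "f \<in> sup.space" "f' \<in> sup.space"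
  shows "approximates (\<lambda>n. L n @ L' n) (f + f')"
proof -
  have le: "N (f + f' - comb (L n @ L' n)) \<le> N (f - comb (L n)) + N (f' - comb (L' n))" for n
    using assms sup.triangle[of "f - comb (L n)" "f' - comb (L' n)"]
    by (simp add: approximates_def comb_sup subspace_diff[OF sup.subspace] algebra_simps)
  have ge: "0 \<le> N (f + f' - comb (L n @ L' n))" for n
    using assms by (intro sup.nonneg subspace_diff[OF sup.subspace] subspace_add[OF sup.subspace]
        comb_sup) (auto simp: approximates_def)
  have lim: "(\<lambda>n. N (f - comb (L n)) + N (f' - comb (L' n))) \<longlonglongrightarrow> 0"
    using assms by (intro tendsto_add_zero) (simp_all add: approximates_def)
  have "(\<lambda>n. N (f + f' - comb (L n @ L' n))) \<longlonglongrightarrow> 0"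
    using le ge by (intro tendsto_sandwich[OF always_eventually always_eventually tendsto_const lim]) blast+
  then show ?thesis using assms by (simp add: approximates_def)
qed

lemma approximates_scale:
  assumes "approximates L f" "f \<in> sup.space"
  shows "approximates (\<lambda>n. scale_comb c (L n)) (c *\<^sub>R f)"
proof -
  have "N (c *\<^sub>R f - comb (scale_comb c (L n))) = \<bar>c\<bar> * N (f - comb (L n))" for n
    using assms by (simp add: approximates_def comb_scale comb_sup subspace_diff[OF sup.subspace]
        flip: sup.scale scaleR_diff_right)
  then show ?thesis
    using assms by (auto simp: approximates_def intro: tendsto_mult_right_zero)
qed

lemma comb_B: "l \<in> combs \<Longrightarrow> comb l \<in> B"
  using approximates_B[OF comb_sup approximates_const] .

text \<open>Approximating sequences can be appended and scaled termwise, which matches the vector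
  operations on their limits.\<close>

lemma subspace_B: "subspace B"
proof (rule subspaceI)
  show "0 \<in> B" using comb_B[of "[]"] by simp
  show "f + f' \<in> B" if "f \<in> B" "f' \<in> B" for f f'
    using that by (meson B_sup B_approximates approximates_B approximates_add
        subspace_add[OF sup.subspace])
  show "c *\<^sub>R f \<in> B" if "f \<in> B" for c f
    using that by (meson B_sup B_approximates approximates_B approximates_scale
        subspace_scale[OF sup.subspace])
qed

text \<open>\<open>B\<close> is closed in the complete space \<open>sup.space\<close>: an
  approximation by elements of \<open>B\<close>, followed by one by combinations, is an
  approximation by combinations.\<close>

lemma banach_on_B: "banach_on B N"
proof (rule banach_on_closed_subspace[OF sup.banach_on_space subspace_B])
  show "B \<subseteq> sup.space" by (auto simp: B_def)
  fix f assume f: "f \<in> sup.space" and close: "\<And>e. e > 0 \<Longrightarrow> \<exists>h\<in>B. N (h - f) < e"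
  have "\<exists>l\<in>combs. N (f - comb l) < e" if e: "e > 0" for e
  proof -
    obtain h where h: "h \<in> B" "N (h - f) < e / 2"
      using close[of "e / 2"] e by auto
    then obtain l where l: "l \<in> combs" "N (h - comb l) < e / 2"
      using e unfolding B_def by (auto dest: spec[of _ "e / 2"])
    have "N (f - comb l) \<le> N (f - h) + N (h - comb l)"
      by (rule sup.triangle_diff[OF f B_sup[OF h(1)] comb_sup[OF l(1)]])
    then show ?thesis
      using l h sup.minus_commute[OF f B_sup[OF h(1)]] by (intro bexI[of _ l]) auto
  qed
  then show "f \<in> B" using f by (simp add: B_def)
qed

lemma vv_RKBS_B: "vv_RKBS X B N"
  unfolding vv_RKBS_def
proof (intro conjI ballI allI impI)
  show "f x = 0" if "f \<in> B" "x \<notin> X" for f x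
    using that B_sup sup.space_V by blast
  show "\<exists>C\<ge>0. \<forall>f\<in>B. norm (f x) \<le> C * N f" if "x \<in> X" for x
    using that sup.p_le_gauge[OF B_sup] CX_pos
    by (intro exI[of _ "CX x"]) (auto simp: mult.commute less_imp_le)
qed (rule banach_on_B)

text \<open>Evaluation at \<open>x\<close> is bounded by \<open>CX x\<close> times the norm, so
  convergence in norm implies convergence at \<open>x\<close>.\<close>

lemma approximates_pointwise:
  assumes "approximates L f" "f \<in> B" "x \<in> X"
  shows "(\<lambda>n. comb (L n) x) \<longlonglongrightarrow> f x"
proof -
  have le: "norm (comb (L n) x - f x) \<le> N (f - comb (L n)) * CX x" for n
    using assms sup.p_le_gauge[of "f - comb (L n)" x]
    by (auto simp: approximates_def B_sup comb_sup subspace_diff[OF sup.subspace] norm_minus_commute)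
  have lim: "(\<lambda>n. N (f - comb (L n)) * CX x) \<longlonglongrightarrow> 0"
    using assms(1) by (auto simp: approximates_def intro: tendsto_mult_left_zero)
  show ?thesis
    using le by (intro LIM_zero_cancel[OF Lim_null_comparison[OF always_eventually lim]]) blast
qed

section \<open>The Banach space \<open>Bd\<close>\<close>

text \<open>The second half of the family makes \<open>comb l \<mapsto> pair_comb g l\<close> a well-defined bounded
  functional. The first half keeps point evaluations bounded; it is redundant when the norm
  of \<open>U\<^sup>\<diamond>\<close> is the dual norm.\<close>

sublocale dual: seminorm_family
  "{g :: 'w \<Rightarrow> 'ud. \<forall>w. w \<notin> W \<longrightarrow> g w = 0}" "W <+> combs"
  "case_sum (\<lambda>w g. norm (g w)) (\<lambda>l g. \<bar>pair_comb g l\<bar>)" "case_sum CW (\<lambda>l. N (comb l))"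
proof
  fix \<sigma> :: "nat \<Rightarrow> 'w \<Rightarrow> 'ud"
  assume *: "\<And>i e. i \<in> W <+> combs \<Longrightarrow> e > 0 \<Longrightarrow> \<exists>M. \<forall>m\<ge>M. \<forall>n\<ge>M.
    case_sum (\<lambda>w g. norm (g w)) (\<lambda>l g. \<bar>pair_comb g l\<bar>) i (\<sigma> m - \<sigma> n) < e"
  have "\<exists>M. \<forall>m\<ge>M. \<forall>n\<ge>M. norm (\<sigma> m w - \<sigma> n w) < e" if "w \<in> W" "e > 0" for w e
    using *[of "Inl w" e] that by (simp add: InlI)
  then obtain g where g: "\<forall>w. w \<notin> W \<longrightarrow> g w = 0" "\<And>w. w \<in> W \<Longrightarrow> (\<lambda>n. \<sigma> n w) \<longlonglongrightarrow> g w"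
    using pointwise_limit_exists[of W \<sigma>] by auto
  have "(\<lambda>n. pair_comb (\<sigma> n - g) l) \<longlonglongrightarrow> 0" if l: "l \<in> combs" for l
  proof -
    \<comment> \<open>The limit is the zero function, written as a multiple of \<open>g\<close> by 0
      so that \<open>pair_comb_scale_left\<close> evaluates it.\<close>
    have "(\<lambda>n. pair_comb (\<sigma> n - g) l) \<longlonglongrightarrow> pair_comb (0 *\<^sub>R g) l"
      using g(2) by (intro pair_comb_tendsto[OF l]) (auto simp: scaleR_fun_def intro: LIM_zero)
    then show ?thesis unfolding pair_comb_scale_left by simp
  qed
  then show "\<exists>g\<in>{g. \<forall>w. w \<notin> W \<longrightarrow> g w = 0}. \<forall>i\<in>W <+> combs.
      (\<lambda>n. case_sum (\<lambda>w g. norm (g w)) (\<lambda>l g. \<bar>pair_comb g l\<bar>) i (\<sigma> n - g)) \<longlonglongrightarrow> 0"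
    using g by (auto intro!: exI[of _ g] tendsto_norm_zero LIM_zero tendsto_rabs_zero)
next
  fix g :: "'w \<Rightarrow> 'ud"
  assume g: "g \<in> {g. \<forall>w. w \<notin> W \<longrightarrow> g w = 0}" "\<And>i. i \<in> W <+> combs \<Longrightarrow>
    case_sum (\<lambda>w g. norm (g w)) (\<lambda>l g. \<bar>pair_comb g l\<bar>) i g = 0"
  then have "norm (g w) = 0" if "w \<in> W" for w
    using g(2)[of "Inl w"] that by (simp add: InlI)
  then show "g = 0" using g(1) by (fastforce simp: fun_eq_iff)
qed (auto simp: subspace_vanishing scaleR_fun_def norm_triangle_ineq less_imp_le[OF CW_pos]
    pair_comb_add_left pair_comb_scale_left[unfolded scaleR_fun_def] abs_mult abs_triangle_ineq
    sup.nonneg comb_sup)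

abbreviation Bd :: "('w \<Rightarrow> 'ud) set"
  where "Bd \<equiv> dual.space"

abbreviation Nd :: "('w \<Rightarrow> 'ud) \<Rightarrow> real"
  where "Nd \<equiv> dual.gauge"

lemma Bd_eval_le: "g \<in> Bd \<Longrightarrow> w \<in> W \<Longrightarrow> norm (g w) \<le> Nd g * CW w"
  using dual.p_le_gauge[of g "Inl w"] by (simp add: InlI)

lemma Bd_comb_le: "g \<in> Bd \<Longrightarrow> l \<in> combs \<Longrightarrow> \<bar>pair_comb g l\<bar> \<le> Nd g * N (comb l)"
  using dual.p_le_gauge[of g "Inr l"] by (simp add: InrI)

lemma vv_RKBS_Bd: "vv_RKBS W Bd Nd"
  unfolding vv_RKBS_def
proof (intro conjI ballI allI impI)
  show "g w = 0" if "g \<in> Bd" "w \<notin> W" for g w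
    using that dual.space_V by blast
  show "\<exists>C\<ge>0. \<forall>g\<in>Bd. norm (g w) \<le> C * Nd g" if "w \<in> W" for w
    using that Bd_eval_le CW_pos
    by (intro exI[of _ "CW w"]) (auto simp: mult.commute less_imp_le)
qed (rule dual.banach_on_space)

text \<open>The difference is the value at a single list representing
  \<open>comb l - comb l'\<close>. For \<open>f = comb l = comb l'\<close> this shows that the value
  depends only on the combination; for general \<open>f\<close> it makes values along approximating
  sequences Cauchy.\<close>

lemma Bd_comb_diff_le:
  assumes "g \<in> Bd" "l \<in> combs" "l' \<in> combs" "f \<in> B"
  shows "\<bar>pair_comb g l - pair_comb g l'\<bar> \<le> Nd g * (N (f - comb l) + N (f - comb l'))"
proof -
  have "\<bar>pair_comb g l - pair_comb g l'\<bar> = \<bar>pair_comb g (l @ scale_comb (-1) l')\<bar>"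
    by (simp add: pair_comb_scale)
  also have "\<dots> \<le> Nd g * N (comb l - comb l')"
    using Bd_comb_le[of g "l @ scale_comb (-1) l'"] assms by (simp add: comb_scale)
  also have "\<dots> \<le> Nd g * (N (comb l - f) + N (f - comb l'))"
    using assms by (intro mult_left_mono sup.triangle_diff dual.nonneg comb_sup B_sup)
  also have "N (comb l - f) = N (f - comb l)"
    using assms by (intro sup.minus_commute comb_sup B_sup)
  finally show ?thesis .
qed

section \<open>The pairing of \<open>Bd\<close> with \<open>B\<close>\<close>

definition pB :: "('w \<Rightarrow> 'ud) \<Rightarrow> ('x \<Rightarrow> 'u) \<Rightarrow> real"
  where "pB g f = lim (\<lambda>n. pair_comb g ((SOME L. approximates L f) n))"

text \<open>This frees \<open>pB\<close> from the choice in its definition: the values along the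
  chosen sequence converge, and along any other sequence \<open>L\<close> they differ by a null
  sequence.\<close>

lemma pB_tendsto:
  assumes g: "g \<in> Bd" and f: "f \<in> B" and L: "approximates L f"
  shows "(\<lambda>n. pair_comb g (L n)) \<longlonglongrightarrow> pB g f"
proof -
  define L' where "L' = (SOME L. approximates L f)"
  have L': "approximates L' f"
    unfolding L'_def using L by (rule someI[of "\<lambda>L. approximates L f"])
  have combs: "L n \<in> combs" "L' n \<in> combs" for n
    using L L' by (auto simp: approximates_def)
  have "Cauchy (\<lambda>n. pair_comb g (L' n))"
  proof (rule CauchyI)
    fix e :: real assume e: "e > 0"
    have "(\<lambda>n. Nd g * N (f - comb (L' n))) \<longlonglongrightarrow> 0"
      using L' by (auto simp: approximates_def intro: tendsto_mult_right_zero)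
    then have "\<forall>\<^sub>F n in sequentially. Nd g * N (f - comb (L' n)) < e / 2"
      using e by (intro order_tendstoD(2)) auto
    then obtain M where M: "\<And>n. n \<ge> M \<Longrightarrow> Nd g * N (f - comb (L' n)) < e / 2"
      unfolding eventually_sequentially by blast
    have "norm (pair_comb g (L' m) - pair_comb g (L' n)) < e" if "m \<ge> M" "n \<ge> M" for m n
      using Bd_comb_diff_le[OF g combs(2)[of m] combs(2)[of n] f] M[OF that(1)] M[OF that(2)]
      by (simp add: distrib_left)
    then show "\<exists>M. \<forall>m\<ge>M. \<forall>n\<ge>M. norm (pair_comb g (L' m) - pair_comb g (L' n)) < e" by blast
  qed
  then have lim: "(\<lambda>n. pair_comb g (L' n)) \<longlonglongrightarrow> pB g f"
    by (simp add: pB_def L'_def Cauchy_convergent_iff convergent_LIMSEQ_iff)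
  have "(\<lambda>n. pair_comb g (L n) - pair_comb g (L' n)) \<longlonglongrightarrow> 0"
  proof (rule Lim_null_comparison)
    show "\<forall>\<^sub>F n in sequentially. norm (pair_comb g (L n) - pair_comb g (L' n)) \<le>
        Nd g * (N (f - comb (L n)) + N (f - comb (L' n)))"
      using Bd_comb_diff_le[OF g combs(1) combs(2) f] by simp
    show "(\<lambda>n. Nd g * (N (f - comb (L n)) + N (f - comb (L' n)))) \<longlonglongrightarrow> 0"
      using L L' by (intro tendsto_mult_right_zero tendsto_add_zero) (auto simp: approximates_def)
  qed
  from tendsto_add[OF this lim] show ?thesis by simp
qed

lemma pB_comb: "g \<in> Bd \<Longrightarrow> l \<in> combs \<Longrightarrow> pB g (comb l) = pair_comb g l"
  using pB_tendsto[OF _ comb_B approximates_const] LIMSEQ_unique tendsto_const by blast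

lemma pB_sec: "g \<in> Bd \<Longrightarrow> w \<in> W \<Longrightarrow> pB g (sec w u) = pU (g w) u"
  using pB_comb[of g "[(w, u)]"] by simp

text \<open>The bound holds for combinations by \<open>Bd_comb_le\<close> and passes to the limit,
  because the norms of the approximants exceed \<open>N f\<close> by at most a null
  sequence.\<close>

lemma pB_le:
  assumes g: "g \<in> Bd" and f: "f \<in> B"
  shows "\<bar>pB g f\<bar> \<le> Nd g * N f"
proof -
  obtain L where L: "approximates L f" using B_approximates[OF f] by blast
  have "\<bar>pair_comb g (L n)\<bar> \<le> Nd g * (N f + N (f - comb (L n)))" for n
  proof -
    have l: "L n \<in> combs" using L by (simp add: approximates_def)
    have "N (comb (L n)) \<le> N f + N (f - comb (L n))"
      using sup.triangle_le[OF comb_sup[OF l] B_sup[OF f]]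
        sup.minus_commute[OF comb_sup[OF l] B_sup[OF f]] by simp
    then show ?thesis
      using Bd_comb_le[OF g l] mult_left_mono[OF _ dual.nonneg[OF g]] order_trans by blast
  qed
  moreover have "(\<lambda>n. Nd g * (N f + N (f - comb (L n)))) \<longlonglongrightarrow> Nd g * (N f + 0)"
    using L by (intro tendsto_intros) (auto simp: approximates_def)
  ultimately show ?thesis
    using LIMSEQ_le[OF tendsto_rabs[OF pB_tendsto[OF g f L]]] by auto
qed

text \<open>Each identity holds for \<open>pair_comb\<close> before the limit. In the second
  argument this needs appended or scaled sequences, which \<open>pB_tendsto\<close> permits; in the
  first argument one sequence serves all terms.\<close>

lemma bilinear_pB: "bilinear_on Bd B pB"
  unfolding bilinear_on_def
proof (intro conjI ballI allI)
  show "pB g (f + f') = pB g f + pB g f'" if "g \<in> Bd" "f \<in> B" "f' \<in> B" for g f f'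
  proof -
    obtain L L' where L: "approximates L f" "approximates L' f'"
      using B_approximates \<open>f \<in> B\<close> \<open>f' \<in> B\<close> by metis
    show ?thesis
      using tendsto_add[OF pB_tendsto[OF that(1,2) L(1)] pB_tendsto[OF that(1,3) L(2)]]
        pB_tendsto[OF that(1) subspace_add[OF subspace_B that(2,3)]
          approximates_add[OF L B_sup[OF that(2)] B_sup[OF that(3)]]] LIMSEQ_unique
      by simp blast
  qed
  show "pB g (c *\<^sub>R f) = c * pB g f" if "g \<in> Bd" "f \<in> B" for g c f
  proof -
    obtain L where L: "approximates L f"
      using B_approximates \<open>f \<in> B\<close> by metis
    show ?thesis
      using tendsto_mult_left[OF pB_tendsto[OF that L], of c]
        pB_tendsto[OF that(1) subspace_scale[OF subspace_B that(2)]
          approximates_scale[OF L B_sup[OF that(2)]], of c] LIMSEQ_unique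
      by (simp add: pair_comb_scale) blast
  qed
  show "pB (g + g') f = pB g f + pB g' f" if "g \<in> Bd" "g' \<in> Bd" "f \<in> B" for g g' f
  proof -
    obtain L where L: "approximates L f"
      using B_approximates \<open>f \<in> B\<close> by metis
    show ?thesis
      using tendsto_add[OF pB_tendsto[OF that(1,3) L] pB_tendsto[OF that(2,3) L]]
        pB_tendsto[OF subspace_add[OF dual.subspace that(1,2)] that(3) L] LIMSEQ_unique
      by (simp add: pair_comb_add_left) blast
  qed
  show "pB (c *\<^sub>R g) f = c * pB g f" if "g \<in> Bd" "f \<in> B" for c g f
  proof -
    obtain L where L: "approximates L f"
      using B_approximates \<open>f \<in> B\<close> by metis
    show ?thesis
      using tendsto_mult_left[OF pB_tendsto[OF that L], of c]
        pB_tendsto[OF subspace_scale[OF dual.subspace that(1)] that(2) L, of c] LIMSEQ_unique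
      by (simp add: pair_comb_scale_left) blast
  qed
qed

section \<open>Reproducing property and nondegeneracy\<close>

lemma sec_dual_Bd:
  assumes x: "x \<in> X"
  shows "sec_dual x ud \<in> Bd"
proof -
  obtain C where C: "C \<ge> 0" "\<And>w. w \<in> W \<Longrightarrow> norm (twin_op_dual pU (K x w) ud) \<le> C * CW w"
    using bound_dual[OF x, of ud] by blast
  obtain D where D: "D \<ge> 0" "\<And>u. \<bar>pU ud u\<bar> \<le> D * norm u"
    using pU_bounded_right by blast
  \<comment> \<open>The constant \<open>C\<close> bounds the values at points of \<open>W\<close>.
    On combinations the functional is evaluation at \<open>x\<close> followed by
    \<open>pU ud\<close>, hence bounded by \<open>D * CX x\<close>. The sum serves both.\<close>
  have "dual.bounded_by (C + D * CX x) (sec_dual x ud)"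
    unfolding dual.bounded_by_def
  proof (intro conjI ballI)
    show "0 \<le> C + D * CX x" using C D CX_pos[OF x] by simp
    fix i assume i: "i \<in> W <+> combs"
    show "case_sum (\<lambda>w g. norm (g w)) (\<lambda>l g. \<bar>pair_comb g l\<bar>) i (sec_dual x ud)
        \<le> (C + D * CX x) * case_sum CW (\<lambda>l. N (comb l)) i"
    proof (cases i)
      case (Inl w)
      then have "w \<in> W" using i by auto
      moreover have "0 \<le> D * CX x * CW w"
        using D CX_pos[OF x] CW_pos[OF \<open>w \<in> W\<close>] by simp
      ultimately show ?thesis
        using Inl C(2)[of w] by (simp add: ker_section_dual_def distrib_right)
    next
      case (Inr l)
      then have l: "l \<in> combs" using i by auto
      have "\<bar>pair_comb (sec_dual x ud) l\<bar> \<le> D * norm (comb l x)"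
        using D(2) by (simp add: pair_comb_sec_dual[OF x l])
      also have "\<dots> \<le> D * (N (comb l) * CX x)"
        using sup.p_le_gauge[OF comb_sup[OF l] x] D(1) by (rule mult_left_mono)
      also have "\<dots> \<le> (C + D * CX x) * N (comb l)"
        using C(1) sup.nonneg[OF comb_sup[OF l]] by (simp add: algebra_simps)
      finally show ?thesis using Inr by simp
    qed
  qed
  then show ?thesis
    by (intro dual.spaceI) (auto simp: ker_section_dual_def)
qed

text \<open>The identity is \<open>pair_comb_sec_dual\<close> on combinations and extends to
  \<open>B\<close> because evaluation at \<open>x\<close> and \<open>pU ud\<close> are
  continuous.\<close>

lemma pB_sec_dual:
  assumes x: "x \<in> X" and f: "f \<in> B"
  shows "pB (sec_dual x ud) f = pU ud (f x)"
proof -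
  obtain L where L: "approximates L f" using B_approximates[OF f] by blast
  have "(\<lambda>n. pU ud (comb (L n) x)) \<longlonglongrightarrow> pU ud (f x)"
    by (intro tendsto_pU tendsto_const approximates_pointwise[OF L f x])
  moreover have "(\<lambda>n. pU ud (comb (L n) x)) = (\<lambda>n. pair_comb (sec_dual x ud) (L n))"
    using L by (simp add: approximates_def pair_comb_sec_dual[OF x])
  ultimately show ?thesis
    using pB_tendsto[OF sec_dual_Bd[OF x] f L] LIMSEQ_unique by metis
qed

lemma sec_B: "w \<in> W \<Longrightarrow> sec w u \<in> B"
  using comb_B[of "[(w, u)]"] by simp

text \<open>Nondegeneracy follows from reproduction: pairing with the sections recovers all
  \<open>pU ud (f x)\<close> and all \<open>pU (g w) u\<close>, and \<open>pU\<close> is itself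
  nondegenerate.\<close>

lemma adjoint_pair: "adjoint_vv_RKBS_pair pU X B N W Bd Nd pB K"
proof -
  have "f = 0" if f: "f \<in> B" "\<forall>g\<in>Bd. pB g f = 0" for f
  proof
    fix x
    show "f x = 0 x"
    proof (cases "x \<in> X")
      case True
      then have "pU ud (f x) = 0" for ud
        using f(2) sec_dual_Bd[OF True, of ud] pB_sec_dual[OF True f(1), of ud] by simp
      then show ?thesis using pU_eq_0_right by simp
    qed (use sup.space_V[OF B_sup[OF f(1)]] in simp)
  qed
  moreover have "g = 0" if g: "g \<in> Bd" "\<forall>f\<in>B. pB g f = 0" for g
  proof
    fix w
    show "g w = 0 w"
    proof (cases "w \<in> W")
      case True
      then have "pU (g w) u = 0" for u
        using g(2) sec_B[OF True, of u] pB_sec[OF g(1) True, of u] by simp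
      then show ?thesis using pU_eq_0_left by simp
    qed (use dual.space_V[OF g(1)] in simp)
  qed
  ultimately have "dual_pairing Bd B pB"
    using bilinear_pB by (auto simp: dual_pairing_def)
  moreover have "continuous_pairing Bd Nd B N pB"
    using dual.normed_carrier_axioms banach_on_normed_carrier[OF banach_on_B] bilinear_pB pB_le
    by (rule continuous_pairingI)
  ultimately show ?thesis
    unfolding adjoint_vv_RKBS_pair_def
    using vv_RKBS_B vv_RKBS_Bd twin sec_dual_Bd pB_sec_dual sec_B pB_sec by simp
qed

text \<open>The supremum \<open>s\<close> is shown to be an admissible bound in the definition of
  the gauge, hence at least \<open>Nd g\<close>; the other inequality is
  \<open>pB_le\<close>.\<close>

lemma Nd_eq_SUP:
  assumes norming: "\<And>ud. norm ud = (SUP u\<in>{u. norm u \<le> 1}. \<bar>pU ud u\<bar>)"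
    and bound: "\<And>x w u. x \<in> X \<Longrightarrow> w \<in> W \<Longrightarrow> norm (twin_op pU (K x w) u) \<le> CX x * CW w * norm u"
    and g: "g \<in> Bd"
  shows "Nd g = (SUP f\<in>{f \<in> B. N f \<le> 1}. \<bar>pB g f\<bar>)"
proof -
  define s where "s = (SUP f\<in>{f \<in> B. N f \<le> 1}. \<bar>pB g f\<bar>)"
  have zero: "0 \<in> {f \<in> B. N f \<le> 1}"
    using subspace_0[OF subspace_B] by simp
  have le: "\<bar>pB g f\<bar> \<le> Nd g" if "f \<in> {f \<in> B. N f \<le> 1}" for f
    using that pB_le[OF g, of f] mult_left_mono[OF _ dual.nonneg[OF g], of "N f" 1] by auto
  then have bdd: "bdd_above ((\<lambda>f. \<bar>pB g f\<bar>) ` {f \<in> B. N f \<le> 1})"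
    by (rule bdd_aboveI2)
  have upper: "\<bar>pB g f\<bar> \<le> s" if "f \<in> B" "N f \<le> 1" for f
    unfolding s_def using that by (intro cSUP_upper[OF _ bdd]) simp
  then have s0: "0 \<le> s"
    using zero abs_ge_zero order_trans by blast
  have pB_le_s: "\<bar>pB g f\<bar> \<le> s * N f" if f: "f \<in> B" for f
  proof (cases "N f = 0")
    case True
    then show ?thesis using pB_le[OF g f] by simp
  next
    case False
    then have pos: "N f > 0" using sup.nonneg[OF B_sup[OF f]] by simp
    \<comment> \<open>Normalising \<open>f\<close> brings it into the unit ball, where
      \<open>s\<close> is an upper bound.\<close>
    have "N (inverse (N f) *\<^sub>R f) = 1"
      using pos by (simp add: sup.scale[OF B_sup[OF f]])
    moreover have "inverse (N f) *\<^sub>R f \<in> B"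
      using subspace_scale[OF subspace_B f] .
    ultimately have "\<bar>pB g (inverse (N f) *\<^sub>R f)\<bar> \<le> s"
      using upper by simp
    moreover have "pB g (inverse (N f) *\<^sub>R f) = inverse (N f) * pB g f"
      using bilinear_pB g f by (simp add: bilinear_on_def)
    ultimately have "inverse (N f) * \<bar>pB g f\<bar> \<le> s"
      using pos by (simp add: abs_mult)
    then show ?thesis
      using pos by (simp add: field_simps)
  qed
  have "dual.bounded_by s g"
    unfolding dual.bounded_by_def
  proof (intro conjI ballI s0)
    fix i assume i: "i \<in> W <+> combs"
    show "case_sum (\<lambda>w g. norm (g w)) (\<lambda>l g. \<bar>pair_comb g l\<bar>) i g
        \<le> s * case_sum CW (\<lambda>l. N (comb l)) i"
    proof (cases i)
      case (Inl w)
      then have w: "w \<in> W" using i by auto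
      have "\<bar>pU (g w) u\<bar> \<le> s * CW w" if u: "norm u \<le> 1" for u
      proof -
        \<comment> \<open>The extra bound on the kernel says that for \<open>u\<close> in the unit
          ball the section has weighted norm at most \<open>CW w\<close>.\<close>
        have "norm (twin_op pU (K x w) u) \<le> CW w * CX x" if "x \<in> X" for x
        proof -
          have "norm (twin_op pU (K x w) u) \<le> CX x * CW w * norm u"
            by (rule bound[OF that w])
          also have "\<dots> \<le> CX x * CW w * 1"
            using u CX_pos[OF that] CW_pos[OF w] by (intro mult_left_mono) simp_all
          finally show ?thesis by (simp add: mult.commute)
        qed
        then have "N (sec w u) \<le> CW w"
          using CW_pos[OF w]
          by (intro sup.gauge_le) (auto simp: sup.bounded_by_def ker_section_def)
        then show ?thesis
          using pB_le_s[OF sec_B[OF w], of u] pB_sec[OF g w, of u] mult_left_mono[OF _ s0]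
          by fastforce
      qed
      \<comment> \<open>By \<open>norming\<close>, the bound on \<open>pU (g w) u\<close> over the
        unit ball is a bound on the norm of \<open>g w\<close>.\<close>
      then have "norm (g w) \<le> s * CW w"
        unfolding norming[of "g w"] by (intro cSUP_least) (auto intro: exI[of _ 0])
      then show ?thesis using Inl by simp
    next
      case (Inr l)
      then have "l \<in> combs" using i by auto
      then show ?thesis
        using Inr pB_le_s[OF comb_B] pB_comb[OF g] by fastforce
    qed
  qed
  then have "Nd g \<le> s" by (rule dual.gauge_le)
  moreover have "s \<le> Nd g"
    unfolding s_def using zero le by (intro cSUP_least) auto
  ultimately show ?thesis by (simp add: s_def)
qed

end

subsection \<open>Properties of reproducing kernels\<close>

text \<open>The pairing of a dual section of \<open>K\<close> with a section of \<open>K'\<close>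
  can be reproduced from either side, giving \<open>K\<close> one way and \<open>K'\<close> the
  other. This yields uniqueness and, for \<open>K' = K\<close>, the formula for the kernel.\<close>

lemma adjoint_pair_kernel_eq:
  assumes dual: "dual_pairing UNIV UNIV pU"
    and K: "adjoint_vv_RKBS_pair pU X B N W Bd Nd pB K"
    and K': "adjoint_vv_RKBS_pair pU X B N W Bd Nd pB K'"
    and "x \<in> X" "w \<in> W"
  shows "K x w ud u = pB (ker_section_dual pU W K x ud) (ker_section pU X K' w u)"
    and "K' x w ud u = pB (ker_section_dual pU W K x ud) (ker_section pU X K' w u)"
proof -
  have twin: "K x w \<in> Twin pU" "K' x w \<in> Twin pU"
    using K K' \<open>x \<in> X\<close> \<open>w \<in> W\<close> by (auto simp: adjoint_vv_RKBS_pair_def)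
  have dual_sec: "ker_section_dual pU W K x ud \<in> Bd"
    "\<forall>f\<in>B. pU ud (f x) = pB (ker_section_dual pU W K x ud) f"
    using K \<open>x \<in> X\<close> by (auto simp: adjoint_vv_RKBS_pair_def)
  have sec: "ker_section pU X K' w u \<in> B"
    "\<forall>g\<in>Bd. pU (g w) u = pB g (ker_section pU X K' w u)"
    using K' \<open>w \<in> W\<close> by (auto simp: adjoint_vv_RKBS_pair_def)
  show "K x w ud u = pB (ker_section_dual pU W K x ud) (ker_section pU X K' w u)"
    using sec(2)[rule_format, OF dual_sec(1)] \<open>w \<in> W\<close> twin_op_dual(2)[OF dual twin(1)]
    by (simp add: ker_section_dual_def)
  show "K' x w ud u = pB (ker_section_dual pU W K x ud) (ker_section pU X K' w u)"
    using dual_sec(2)[rule_format, OF sec(1)] \<open>x \<in> X\<close> twin_op(2)[OF dual twin(2)]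
    by (simp add: ker_section_def)
qed

lemma vv_RKBS_eval_bound:
  assumes "vv_RKBS X B N"
  shows "\<exists>C. (\<forall>x\<in>X. C x > 0) \<and> (\<forall>x\<in>X. \<forall>f\<in>B. norm (f x) \<le> C x * N f)"
proof -
  have nonneg: "0 \<le> N f" if "f \<in> B" for f
    using assms that by (simp add: vv_RKBS_def banach_on_def)
  have "\<exists>C>0. \<forall>f\<in>B. norm (f x) \<le> C * N f" if "x \<in> X" for x
  proof -
    have "\<exists>C\<ge>0. \<forall>f\<in>B. norm (f x) \<le> C * N f"
      using assms that by (simp add: vv_RKBS_def)
    then obtain C where C: "C \<ge> 0" "\<forall>f\<in>B. norm (f x) \<le> C * N f"
      by blast
    \<comment> \<open>Adding 1 makes the constant strictly positive, and the inequality persists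
      because \<open>N f\<close> is nonnegative.\<close>
    have "norm (f x) \<le> (C + 1) * N f" if "f \<in> B" for f
      using bspec[OF C(2) that] nonneg[OF that] by (simp add: distrib_right)
    then show ?thesis
      using C(1) by (intro exI[of _ "C + 1"]) simp
  qed
  then show ?thesis by metis
qed

theorem theorem3p5:
  fixes pU :: "'ud::banach \<Rightarrow> 'u::banach \<Rightarrow> real"
    and X :: "'x set" and W :: "'w set"
    and K :: "'x \<Rightarrow> 'w \<Rightarrow> 'ud \<Rightarrow> 'u \<Rightarrow> real"
  assumes "dual_pairing UNIV UNIV pU"
  shows
    "(\<forall>B N Bd Nd pB. adjoint_vv_RKBS_pair pU X B N W Bd Nd pB K \<longrightarrow>
        (\<forall>K'. adjoint_vv_RKBS_pair pU X B N W Bd Nd pB K' \<longrightarrow>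
           (\<forall>x\<in>X. \<forall>w\<in>W. K' x w = K x w)) \<and>
        (\<forall>x\<in>X. \<forall>w\<in>W. \<forall>u ud.
           K x w ud u = pB (ker_section_dual pU W K x ud) (ker_section pU X K w u) \<and>
           pB (ker_section_dual pU W K x ud) (ker_section pU X K w u)
             = pU (twin_op_dual pU (K x w) ud) u \<and>
           pU (twin_op_dual pU (K x w) ud) u = pU ud (twin_op pU (K x w) u)) \<and>
        (\<exists>CX CW. (\<forall>x\<in>X. CX x > 0) \<and> (\<forall>w\<in>W. CW w > 0) \<and>
           (\<forall>x\<in>X. \<forall>w\<in>W. \<forall>u.
              norm (twin_op pU (K x w) u) \<le> CX x * N (ker_section pU X K w u)) \<and>
           (\<forall>x\<in>X. \<forall>w\<in>W. \<forall>ud.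
              norm (twin_op_dual pU (K x w) ud) \<le> CW w * Nd (ker_section_dual pU W K x ud))))
     \<and>
     (\<forall>CX CW CWU CXUd.
        continuous_pairing UNIV norm UNIV norm pU \<and>
        (\<forall>x\<in>X. \<forall>w\<in>W. K x w \<in> Twin pU) \<and>
        (\<forall>x\<in>X. CX x > 0) \<and> (\<forall>w\<in>W. CW w > 0) \<and>
        (\<forall>w\<in>W. \<forall>u. CWU w u > 0) \<and> (\<forall>x\<in>X. \<forall>ud. CXUd x ud > 0) \<and>
        (\<forall>x\<in>X. \<forall>w\<in>W. \<forall>u. norm (twin_op pU (K x w) u) \<le> CX x * CWU w u) \<and>
        (\<forall>x\<in>X. \<forall>w\<in>W. \<forall>ud. norm (twin_op_dual pU (K x w) ud) \<le> CW w * CXUd x ud)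
        \<longrightarrow>
        (\<exists>B N Bd Nd pB. adjoint_vv_RKBS_pair pU X B N W Bd Nd pB K) \<and>
        ((\<forall>ud. norm ud = (SUP u\<in>{u. norm u \<le> 1}. \<bar>pU ud u\<bar>)) \<and>
         (\<forall>x\<in>X. \<forall>w\<in>W. \<forall>u. norm (twin_op pU (K x w) u) \<le> CX x * CW w * norm u)
         \<longrightarrow>
         (\<exists>B N Bd Nd pB. adjoint_vv_RKBS_pair pU X B N W Bd Nd pB K \<and>
            (\<forall>g\<in>Bd. Nd g = (SUP f\<in>{f \<in> B. N f \<le> 1}. \<bar>pB g f\<bar>)))))"
proof (intro conjI allI impI)
  fix B N Bd Nd pB
  assume K: "adjoint_vv_RKBS_pair pU X B N W Bd Nd pB K"
  show "\<forall>x\<in>X. \<forall>w\<in>W. K' x w = K x w" if "adjoint_vv_RKBS_pair pU X B N W Bd Nd pB K'" for K'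
    using adjoint_pair_kernel_eq[OF assms K that] by (auto simp: fun_eq_iff)
  have twin: "K x w \<in> Twin pU" if "x \<in> X" "w \<in> W" for x w
    using K that by (simp add: adjoint_vv_RKBS_pair_def)
  show "\<forall>x\<in>X. \<forall>w\<in>W. \<forall>u ud.
      K x w ud u = pB (ker_section_dual pU W K x ud) (ker_section pU X K w u) \<and>
      pB (ker_section_dual pU W K x ud) (ker_section pU X K w u)
        = pU (twin_op_dual pU (K x w) ud) u \<and>
      pU (twin_op_dual pU (K x w) ud) u = pU ud (twin_op pU (K x w) u)"
    using adjoint_pair_kernel_eq(1)[OF assms K K] twin_op(2)[OF assms twin]
      twin_op_dual(2)[OF assms twin] by simp
  have RKBS: "vv_RKBS X B N" "vv_RKBS W Bd Nd"
    using K by (simp_all add: adjoint_vv_RKBS_pair_def)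
  obtain CX where CX: "\<forall>x\<in>X. CX x > 0" "\<forall>x\<in>X. \<forall>f\<in>B. norm (f x) \<le> CX x * N f"
    using vv_RKBS_eval_bound[OF RKBS(1)] by blast
  obtain CW where CW: "\<forall>w\<in>W. CW w > 0" "\<forall>w\<in>W. \<forall>g\<in>Bd. norm (g w) \<le> CW w * Nd g"
    using vv_RKBS_eval_bound[OF RKBS(2)] by blast
  have "norm (twin_op pU (K x w) u) \<le> CX x * N (ker_section pU X K w u)"
    if "x \<in> X" "w \<in> W" for x w u
  proof -
    have "ker_section pU X K w u \<in> B"
      using K that by (simp add: adjoint_vv_RKBS_pair_def)
    \<comment> \<open>The kernel bound is the evaluation bound at \<open>x\<close> for the section
      itself.\<close>
    from bspec[OF bspec[OF CX(2) that(1)] this] show ?thesis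
      using that by (simp add: ker_section_def)
  qed
  moreover have "norm (twin_op_dual pU (K x w) ud) \<le> CW w * Nd (ker_section_dual pU W K x ud)"
    if "x \<in> X" "w \<in> W" for x w ud
  proof -
    have "ker_section_dual pU W K x ud \<in> Bd"
      using K that by (simp add: adjoint_vv_RKBS_pair_def)
    from bspec[OF bspec[OF CW(2) that(2)] this] show ?thesis
      using that by (simp add: ker_section_dual_def)
  qed
  ultimately show "\<exists>CX CW. (\<forall>x\<in>X. CX x > 0) \<and> (\<forall>w\<in>W. CW w > 0) \<and>
      (\<forall>x\<in>X. \<forall>w\<in>W. \<forall>u. norm (twin_op pU (K x w) u) \<le> CX x * N (ker_section pU X K w u)) \<and>
      (\<forall>x\<in>X. \<forall>w\<in>W. \<forall>ud.
        norm (twin_op_dual pU (K x w) ud) \<le> CW w * Nd (ker_section_dual pU W K x ud))"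
    using CX(1) CW(1) by blast
next
  fix CX :: "'x \<Rightarrow> real" and CW :: "'w \<Rightarrow> real"
    and CWU :: "'w \<Rightarrow> 'u \<Rightarrow> real" and CXUd :: "'x \<Rightarrow> 'ud \<Rightarrow> real"
  assume *: "continuous_pairing UNIV norm UNIV norm pU \<and>
    (\<forall>x\<in>X. \<forall>w\<in>W. K x w \<in> Twin pU) \<and>
    (\<forall>x\<in>X. CX x > 0) \<and> (\<forall>w\<in>W. CW w > 0) \<and>
    (\<forall>w\<in>W. \<forall>u. CWU w u > 0) \<and> (\<forall>x\<in>X. \<forall>ud. CXUd x ud > 0) \<and>
    (\<forall>x\<in>X. \<forall>w\<in>W. \<forall>u. norm (twin_op pU (K x w) u) \<le> CX x * CWU w u) \<and>
    (\<forall>x\<in>X. \<forall>w\<in>W. \<forall>ud. norm (twin_op_dual pU (K x w) ud) \<le> CW w * CXUd x ud)"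
  \<comment> \<open>The values of \<open>CWU\<close> and \<open>CXUd\<close> supply the constants
    for each section.\<close>
  interpret bounded_twin_kernel pU X W K CX CW
  proof
    show "\<exists>C\<ge>0. \<forall>x\<in>X. norm (twin_op pU (K x w) u) \<le> C * CX x" if "w \<in> W" for w u
      using * that by (intro exI[of _ "CWU w u"]) (simp add: mult.commute less_imp_le)
    show "\<exists>C\<ge>0. \<forall>w\<in>W. norm (twin_op_dual pU (K x w) ud) \<le> C * CW w" if "x \<in> X" for x ud
      using * that by (intro exI[of _ "CXUd x ud"]) (simp add: mult.commute less_imp_le)
  qed (use assms * in auto)
  show "\<exists>B N Bd Nd pB. adjoint_vv_RKBS_pair pU X B N W Bd Nd pB K"
    using adjoint_pair by blast
  assume "(\<forall>ud. norm ud = (SUP u\<in>{u. norm u \<le> 1}. \<bar>pU ud u\<bar>)) \<and>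
    (\<forall>x\<in>X. \<forall>w\<in>W. \<forall>u. norm (twin_op pU (K x w) u) \<le> CX x * CW w * norm u)"
  then show "\<exists>B N Bd Nd pB. adjoint_vv_RKBS_pair pU X B N W Bd Nd pB K \<and>
      (\<forall>g\<in>Bd. Nd g = (SUP f\<in>{f \<in> B. N f \<le> 1}. \<bar>pB g f\<bar>))"
    using adjoint_pair Nd_eq_SUP by blast
qed

end
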